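(* Let $H$ and $U$ be Hilbert spaces, let $A$ generate a $C_0$ semigroup on $H$, let $B\in\mathcal{L}(U;H)$, and let $T>0$. Let $\mathcal{G}$ be a closed vector subspace of $L^2(0,T;U)$ and $\mathcal{W}$ a closed vector subspace of $L^2(0,T;H)$. Assume the following unique continuation property: if, for some $(z_T,g,w)\in H\times\mathcal{G}\times\mathcal{W}$, the solution $z$ of $z'+A^*z=w$ for $t\in(0,T)$, $z(T)=z_T$, satisfies $B^*z=g$ in $(0,T)$, then $z_T=0$, $g=0$ and $w=0$. Assume further the following observability inequality: there exists a constant $C>0$ such that for all $z_T\in H$, the solution $z$ of $z'+A^*z=0$ for $t\in(0,T)$, $z(T)=z_T$, satisfies $$\|z_T\|_H\le C\,\|B^*z\|_{L^2(0,T;U)}.$$ Assume moreover that the vector spaces $\mathcal{G}$ and $\mathcal{W}$ are of finite dimension. Then for any $y_0,y_1\in H$, $g_*\in\mathcal{G}$ and $w_*\in\mathcal{W}$, there exists a control function $u\in L^2(0,T;U)$ such that $\mathbb{P}_{\mathcal{G}}u=g_*$ and the solution $y$ of $$y'=Ay+Bu \ \text{ for } t\in(0,T),\qquad y(0)=y_0,$$ satisfies $y(T)=y_1$ and $\mathbb{P}_{\mathcal{W}}y=w_*$.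
   Context: $\mathbb{P}_{\mathcal{G}}$ denotes the orthogonal projection onto $\mathcal{G}$ in $L^2(0,T;U)$ and $\mathbb{P}_{\mathcal{W}}$ the orthogonal projection onto $\mathcal{W}$ in $L^2(0,T;H)$. Solutions of the evolution equations are the usual mild (semigroup) solutions, which belong to $C^0([0,T];H)$; the equation for $z$ is solved backward in time from $z(T)=z_T$. $A^*$, $B^*$ denote adjoints. *)

theory Defs
  imports "HOL-Analysis.Analysis"
begin

text \<open>
  Hilbert spaces are the types of sort \<open>{real_inner, banach}\<close>. A complex Hilbert space is one of
  them for the real part of its inner product; norms, adjoints of complex-linear operators and
  orthogonal projections onto complex subspaces are the same for both structures.
  Separability is not assumed.
\<close>

section \<open>Semigroups and their generators\<close>

definition C0_semigroup :: "(real \<Rightarrow> 'h \<Rightarrow> 'h::real_normed_vector) \<Rightarrow> bool" where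
  "C0_semigroup S \<longleftrightarrow>
     (\<forall>t\<ge>0. bounded_linear (S t)) \<and>
     (\<forall>x. S 0 x = x) \<and>
     (\<forall>s\<ge>0. \<forall>t\<ge>0. \<forall>x. S (s + t) x = S s (S t x)) \<and>
     (\<forall>x. ((\<lambda>t. S t x) \<longlongrightarrow> x) (at_right 0))"

text \<open>An unbounded operator is represented by its graph, so that its domain is part of it.\<close>

definition generator :: "(real \<Rightarrow> 'h \<Rightarrow> 'h::real_normed_vector) \<Rightarrow> ('h \<times> 'h) set" where
  "generator S = {(x, y). ((\<lambda>t. (1 / t) *\<^sub>R (S t x - x)) \<longlongrightarrow> y) (at_right 0)}"

definition generates :: "('h \<times> 'h) set \<Rightarrow> (real \<Rightarrow> 'h \<Rightarrow> 'h::real_normed_vector) \<Rightarrow> bool" where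
  "generates A S \<longleftrightarrow> C0_semigroup S \<and> generator S = A"

definition adjoint_op :: "('h \<times> 'h) set \<Rightarrow> ('h::real_inner \<times> 'h) set" where
  "adjoint_op A = {(x, y). \<forall>(u, v)\<in>A. inner v x = inner u y}"


section \<open>Mild solutions\<close>

text \<open>
  \<open>mild_solution A T f y0 y\<close>: on \<open>[0,T]\<close>, \<open>y\<close> is the mild solution of \<open>y' = A y + f\<close>,
  \<open>y(0) = y0\<close>. The semigroup is determined by its generator on \<open>t \<ge> 0\<close>. For sources \<open>f\<close> that are
  Bochner integrable (such as those in \<open>L\<^sup>2\<close> below), the integrand is Bochner integrable, and the
  library's gauge integral then exists and is the Bochner integral. The library's own Bochner
  integral is not used because it requires a second countable codomain.
\<close>

definition mild_solution ::
  "('h \<times> 'h) set \<Rightarrow> real \<Rightarrow> (real \<Rightarrow> 'h) \<Rightarrow> 'h \<Rightarrow> (real \<Rightarrow> 'h::banach) \<Rightarrow> bool" where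
  "mild_solution A T f y0 y \<longleftrightarrow>
     (\<exists>S. generates A S \<and>
        (\<forall>t\<in>{0..T}. y t = S t y0 + integral {0..t} (\<lambda>s. S (t - s) (f s))))"

text \<open>
  Mild solution of \<open>z' + A z = w\<close>, \<open>z(T) = zT\<close>: reversing time, \<open>\<zeta>(s) = z(T - s)\<close> solves
  \<open>\<zeta>' = A \<zeta> - w(T - s)\<close>, \<open>\<zeta>(0) = zT\<close>.
\<close>

definition backward_mild_solution ::
  "('h \<times> 'h) set \<Rightarrow> real \<Rightarrow> (real \<Rightarrow> 'h) \<Rightarrow> 'h \<Rightarrow> (real \<Rightarrow> 'h::banach) \<Rightarrow> bool" where
  "backward_mild_solution A T w zT z \<longleftrightarrow>
     mild_solution A T (\<lambda>s. - w (T - s)) zT (\<lambda>s. z (T - s))"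


section \<open>The space \<open>L\<^sup>2(0,T)\<close> of Hilbert space valued functions\<close>

text \<open>
  Elements of \<open>L\<^sup>2\<close> are represented by functions, and equality in \<open>L\<^sup>2\<close> by equality almost
  everywhere. Measurability is strong (Bochner) measurability.
\<close>

definition strongly_measurable :: "'a measure \<Rightarrow> ('a \<Rightarrow> 'b::topological_space) \<Rightarrow> bool" where
  "strongly_measurable M f \<longleftrightarrow>
     (\<exists>s. (\<forall>n::nat. simple_function M (s n)) \<and> (AE x in M. (\<lambda>n. s n x) \<longlonglongrightarrow> f x))"

definition L2 :: "real \<Rightarrow> (real \<Rightarrow> 'b::real_normed_vector) set" where
  "L2 T = {f. strongly_measurable (lebesgue_on {0<..<T}) f \<and>
              integrable (lebesgue_on {0<..<T}) (\<lambda>t. (norm (f t))\<^sup>2)}"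

definition L2_norm :: "real \<Rightarrow> (real \<Rightarrow> 'b::real_normed_vector) \<Rightarrow> real" where
  "L2_norm T f = sqrt (LINT t|lebesgue_on {0<..<T}. (norm (f t))\<^sup>2)"

definition L2_inner :: "real \<Rightarrow> (real \<Rightarrow> 'b::real_inner) \<Rightarrow> (real \<Rightarrow> 'b) \<Rightarrow> real" where
  "L2_inner T f g = (LINT t|lebesgue_on {0<..<T}. inner (f t) (g t))"

definition L2_eq :: "real \<Rightarrow> (real \<Rightarrow> 'b) \<Rightarrow> (real \<Rightarrow> 'b) \<Rightarrow> bool" where
  "L2_eq T f g \<longleftrightarrow> (AE t in lebesgue_on {0<..<T}. f t = g t)"

text \<open>
  The closedness clause, applied to constant sequences, makes \<open>V\<close> invariant under modification on
  null sets, so that \<open>V\<close> stands for a set of equivalence classes.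
\<close>

definition L2_closed_subspace :: "real \<Rightarrow> (real \<Rightarrow> 'b::real_normed_vector) set \<Rightarrow> bool" where
  "L2_closed_subspace T V \<longleftrightarrow>
     V \<subseteq> L2 T \<and>
     (\<lambda>t. 0) \<in> V \<and>
     (\<forall>f\<in>V. \<forall>g\<in>V. (\<lambda>t. f t + g t) \<in> V) \<and>
     (\<forall>c. \<forall>f\<in>V. (\<lambda>t. c *\<^sub>R f t) \<in> V) \<and>
     (\<forall>f g. (\<forall>n. f n \<in> V) \<and> g \<in> L2 T \<and> (\<lambda>n. L2_norm T (\<lambda>t. f n t - g t)) \<longlonglongrightarrow> 0 \<longrightarrow> g \<in> V)"

definition L2_finite_dim :: "real \<Rightarrow> (real \<Rightarrow> 'b::real_normed_vector) set \<Rightarrow> bool" where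
  "L2_finite_dim T V \<longleftrightarrow>
     (\<exists>(n::nat) e. (\<forall>i<n. e i \<in> V) \<and>
        (\<forall>f\<in>V. \<exists>c. L2_eq T f (\<lambda>t. \<Sum>i<n. c i *\<^sub>R e i t)))"

text \<open>\<open>L2_projection T V f p\<close>: the orthogonal projection of \<open>f\<close> onto \<open>V\<close> is (the class of) \<open>p\<close>.\<close>

definition L2_projection ::
  "real \<Rightarrow> (real \<Rightarrow> 'b::real_inner) set \<Rightarrow> (real \<Rightarrow> 'b) \<Rightarrow> (real \<Rightarrow> 'b) \<Rightarrow> bool" where
  "L2_projection T V f p \<longleftrightarrow>
     f \<in> L2 T \<and> p \<in> V \<and> (\<forall>v\<in>V. L2_inner T (\<lambda>t. f t - p t) v = 0)"

end

theory Submission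
  imports Defs
begin

text \<open>
  Write \<open>\<Phi> x = B\<^sup>* S\<^sup>*(T - \<cdot>) x\<close> for the observation of the homogeneous adjoint equation with final state
  \<open>x\<close>, and \<open>y\<^sub>u\<close> for the mild solution of \<open>y' = A y + B u\<close>, \<open>y(0) = 0\<close>. Two duality relations carry
  the proof:
  \<open>\<langle>y\<^sub>u(T), x\<rangle> = \<langle>u, \<Phi> x\<rangle>\<close>, and \<open>\<langle>y\<^sub>u, w\<rangle> = \<langle>u, B\<^sup>* b\<^sub>w\<rangle>\<close> in \<open>L\<^sup>2\<close>, where
  \<open>b\<^sub>w(s) = \<integral>\<^sub>s\<^sup>T S\<^sup>*(r - s) w(r) dr\<close> is minus the backward solution with source \<open>w\<close> and zero final state.

  The observability inequality says that the Gramian \<open>Q x = y\<^sub>u(T)\<close>, \<open>u = \<Phi> x\<close>, is coercive, so \<open>Q\<close> is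
  onto and some control \<open>u\<^sub>1\<close> steers \<open>y0\<close> to \<open>y1\<close> (\<open>gramian_surj\<close>). It remains to correct the
  projections of \<open>u\<^sub>1\<close> and of its trajectory by a null control, that is, some \<open>u\<close> with
  \<open>y\<^sub>u(T) = 0\<close>. As \<open>\<G>\<close> and \<open>\<W>\<close> are spanned by finitely many functions \<open>e\<^sub>i\<close> and \<open>h\<^sub>j\<close>, this
  prescribes finitely many numbers \<open>\<langle>u, e\<^sub>i\<rangle>\<close> and \<open>\<langle>u, B\<^sup>* b\<^sub>w\<rangle>\<close>, \<open>w = h\<^sub>j\<close>. By linear
  algebra (\<open>moments_solvable\<close>) the only obstruction is a combination
  \<open>f = g + B\<^sup>* b\<^sub>w\<close> with \<open>g \<in> \<G>\<close>, \<open>w \<in> \<W>\<close> that is orthogonal to all null controls. Subtracting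
  \<open>\<Phi> (Q\<^sup>-\<^sup>1 (y\<^sub>f(T)))\<close> from \<open>f\<close> leaves a null control orthogonal to itself, so \<open>f = \<Phi> x\<close> for some \<open>x\<close>
  (\<open>annihilator_of_null_controls\<close>). Then \<open>z = S\<^sup>*(T - \<cdot>) x - b\<^sub>w\<close> solves \<open>z' + A\<^sup>* z = w\<close> and
  \<open>B\<^sup>* z = g\<close>; unique continuation gives \<open>g = 0\<close> and \<open>w = 0\<close>, and the obstruction is void.

  The rest of the development makes the objects above meaningful: the adjoints \<open>S\<^sup>*(t)\<close> form a
  strongly continuous semigroup whose generator is exactly \<open>A\<^sup>*\<close> (\<open>generates_adjoint\<close>), which is what allows the hypotheses on backward solutions to be applied;
  the variation of constants integral exists as a gauge integral for every \<open>L\<^sup>2\<close> source in a possibly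
  nonseparable space (\<open>integrable_on_strongly_measurable\<close>); and the second duality relation follows
  from Fubini's theorem (\<open>duhamel_duality\<close>).
\<close>

section \<open>Hilbert spaces\<close>

text \<open>
  A minimizing sequence for the squared distance from \<open>x\<close> to \<open>E\<close> is Cauchy by the parallelogram law, and
  minimality of its limit \<open>p\<close> along each line in \<open>E\<close> forces orthogonality.
\<close>

lemma closed_subspace_projection:
  fixes E :: "'a::{real_inner,banach} set"
  assumes E: "subspace E" "closed E"
  shows "\<exists>p\<in>E. \<forall>e\<in>E. inner (x - p) e = 0"
proof -
  define d where "d = (INF e\<in>E. (norm (x - e))\<^sup>2)"
  have ne: "E \<noteq> {}" using subspace_0[OF E(1)] by auto
  have bdd: "bdd_below ((\<lambda>e. (norm (x - e))\<^sup>2) ` E)"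
    by (rule bdd_belowI[of _ 0]) auto
  have d_le: "d \<le> (norm (x - e))\<^sup>2" if "e \<in> E" for e
    unfolding d_def using bdd that by (rule cINF_lower)
  have "\<exists>e\<in>E. (norm (x - e))\<^sup>2 < d + 1 / real (Suc n)" for n
    using cINF_less_iff[OF ne bdd, of "d + 1 / real (Suc n)"] d_def by simp
  then obtain e where e: "\<And>n. e n \<in> E" "\<And>n. (norm (x - e n))\<^sup>2 < d + 1 / real (Suc n)"
    by metis
  \<comment> \<open>The midpoint of \<open>e m\<close> and \<open>e n\<close> lies in \<open>E\<close>, so its distance from \<open>x\<close> is at least \<open>sqrt d\<close>.\<close>
  have par: "(norm (e m - e n))\<^sup>2 \<le> 2 / real (Suc m) + 2 / real (Suc n)" for m n
  proof -
    let ?a = "x - e m" and ?b = "x - e n"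
    have mid: "(1/2) *\<^sub>R (e m + e n) \<in> E"
      using e(1) E(1) by (simp add: subspace_add subspace_scale)
    have "(norm (?a + ?b))\<^sup>2 + (norm (?a - ?b))\<^sup>2 = 2 * (norm ?a)\<^sup>2 + 2 * (norm ?b)\<^sup>2"
      by (simp only: power2_norm_eq_inner) (simp add: inner_simps inner_commute algebra_simps)
    moreover have "?a - ?b = e n - e m" by simp
    moreover have "?a + ?b = 2 *\<^sub>R (x - (1/2) *\<^sub>R (e m + e n))"
      by (simp add: scaleR_diff_right scaleR_2)
    moreover have "4 * d \<le> (norm (2 *\<^sub>R (x - (1/2) *\<^sub>R (e m + e n))))\<^sup>2"
      using d_le[OF mid] by (simp add: power_mult_distrib)
    ultimately have "(norm (e n - e m))\<^sup>2 \<le> 2 * (norm ?a)\<^sup>2 + 2 * (norm ?b)\<^sup>2 - 4 * d"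
      by simp
    with e(2)[of m] e(2)[of n] show ?thesis
      by (simp add: norm_minus_commute)
  qed
  have "Cauchy e"
  proof (rule metric_CauchyI)
    fix r :: real assume r: "r > 0"
    obtain k where k: "1 / real (Suc k) < r\<^sup>2 / 4"
      using reals_Archimedean[of "r\<^sup>2 / 4"] r by (auto simp: field_simps)
    show "\<exists>M. \<forall>m\<ge>M. \<forall>n\<ge>M. dist (e m) (e n) < r"
    proof (intro exI allI impI)
      fix m n assume mn: "k \<le> m" "k \<le> n"
      have "1 / real (Suc m) \<le> 1 / real (Suc k)" "1 / real (Suc n) \<le> 1 / real (Suc k)"
        using mn by (auto intro!: divide_left_mono)
      with par[of m n] k have "(norm (e m - e n))\<^sup>2 < r\<^sup>2" by simp
      then show "dist (e m) (e n) < r"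
        using r by (simp add: dist_norm power_less_imp_less_base)
    qed
  qed
  then obtain p where p: "e \<longlonglongrightarrow> p" using Cauchy_convergent convergentD by blast
  have pE: "p \<in> E" using E(2) e(1) p closed_sequentially by blast
  have pd: "(norm (x - p))\<^sup>2 \<le> d"
  proof (rule LIMSEQ_le)
    show "(\<lambda>n. (norm (x - e n))\<^sup>2) \<longlonglongrightarrow> (norm (x - p))\<^sup>2"
      using p by (intro tendsto_intros)
    have "(\<lambda>n. d + 1 / real (Suc n)) \<longlonglongrightarrow> d + 0"
      by (intro tendsto_intros) (use LIMSEQ_inverse_real_of_nat in \<open>simp add: inverse_eq_divide\<close>)
    then show "(\<lambda>n. d + 1 / real (Suc n)) \<longlonglongrightarrow> d" by simp
  qed (use e(2) less_imp_le in blast)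
  have "inner (x - p) v = 0" if v: "v \<in> E" for v
  proof (cases "v = 0")
    case False
    define c where "c = inner (x - p) v / inner v v"
    have vv: "inner v v > 0" using False by simp
    have "p + c *\<^sub>R v \<in> E" using pE v E(1) by (simp add: subspace_add subspace_scale)
    from d_le[OF this] pd have "(norm (x - p))\<^sup>2 \<le> (norm (x - (p + c *\<^sub>R v)))\<^sup>2" by linarith
    also have "x - (p + c *\<^sub>R v) = (x - p) - c *\<^sub>R v" by simp
    also have "(norm \<dots>)\<^sup>2 = (norm (x - p))\<^sup>2 - 2 * c * inner (x - p) v + c * c * inner v v"
      unfolding power2_norm_eq_inner by (simp add: inner_diff_left inner_diff_right inner_commute algebra_simps)
    also have "c * c * inner v v = c * inner (x - p) v"
      using vv by (simp add: c_def)
    finally have "c * inner (x - p) v \<le> 0" by simp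
    moreover have "c * inner (x - p) v = (inner (x - p) v)\<^sup>2 / inner v v"
      by (simp add: c_def power2_eq_square)
    ultimately show ?thesis using vv
      by (metis divide_le_0_iff less_le_not_le power2_less_eq_zero_iff)
  qed simp
  with pE show ?thesis by blast
qed

text \<open>
  If \<open>E\<close> missed some \<open>x\<close>, the difference between \<open>x\<close> and its projection would be a nonzero vector
  orthogonal to \<open>E\<close>.
\<close>

lemma closed_subspace_eq_UNIV:
  fixes E :: "'a::{real_inner,banach} set"
  assumes "subspace E" "closed E" "\<And>v. (\<And>e. e \<in> E \<Longrightarrow> inner v e = 0) \<Longrightarrow> v = 0"
  shows "E = UNIV"
proof -
  have "x \<in> E" for x
  proof -
    obtain p where p: "p \<in> E" "\<forall>e\<in>E. inner (x - p) e = 0"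
      using closed_subspace_projection[OF assms(1,2)] by blast
    with assms(3)[of "x - p"] show ?thesis by auto
  qed
  then show ?thesis by blast
qed

text \<open>
  The representing vector is a multiple of the component of any \<open>x\<close> with \<open>f x \<noteq> 0\<close> orthogonal to the
  kernel of \<open>f\<close>.
\<close>

lemma Riesz_representation:
  fixes f :: "'a::{real_inner,banach} \<Rightarrow> real"
  assumes f: "bounded_linear f"
  shows "\<exists>r. \<forall>x. f x = inner x r"
proof (cases "\<forall>x. f x = 0")
  case True
  then show ?thesis by (intro exI[of _ 0]) simp
next
  case False
  interpret bounded_linear f by fact
  obtain x where x: "f x \<noteq> 0" using False by blast
  define E where "E = {x. f x = 0}"
  have "subspace E" by (auto simp: E_def subspace_def zero add scale)
  moreover have "closed E"
    unfolding E_def by (intro closed_Collect_eq continuous_on continuous_intros continuous_on_id)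
  ultimately obtain p where p: "p \<in> E" "\<forall>e\<in>E. inner (x - p) e = 0"
    using closed_subspace_projection by blast
  define q where "q = x - p"
  have fq: "f q = f x" using p by (simp add: q_def diff E_def)
  have qq: "inner q q > 0" using fq x zero by auto
  have "f y = inner y ((f q / inner q q) *\<^sub>R q)" for y
  proof -
    have "y - (f y / f q) *\<^sub>R q \<in> E"
      using fq x by (simp add: E_def diff scale)
    then have "inner q (y - (f y / f q) *\<^sub>R q) = 0" using p q_def by blast
    then have "inner q y = (f y / f q) * inner q q" by (simp add: inner_diff_right)
    then show ?thesis using qq fq x by (simp add: inner_commute)
  qed
  then show ?thesis by blast
qed

text \<open>
  The constant \<^const>\<open>adjoint\<close> is a choice of an operator with this property; Riesz representation
  provides one.
\<close>

lemma inner_adjoint: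
  fixes F :: "'a::{real_inner,banach} \<Rightarrow> 'b::real_inner"
  assumes F: "bounded_linear F"
  shows "inner (F x) y = inner x (adjoint F y)"
proof -
  have "\<exists>r. \<forall>x. inner (F x) y = inner x r" for y
    using Riesz_representation[OF bounded_linear_compose[OF bounded_linear_inner_left F]] by simp
  then obtain G where "\<forall>x y. inner (F x) y = inner x (G y)" by metis
  then show ?thesis using adjoint_unique[of F G] by simp
qed

lemma eq_if_inner_eq:
  fixes x y :: "'a::real_inner"
  assumes "\<And>v. inner v x = inner v y"
  shows "x = y"
  using assms vector_eq_rdot[of x y] by (simp add: inner_commute)

text \<open>
  Norms of adjoints and of weakly defined vectors are estimated by testing.
\<close>

lemma norm_le_if_inner_le:
  fixes x :: "'a::real_inner"
  assumes "\<And>v. \<bar>inner v x\<bar> \<le> c * norm v" "c \<ge> 0"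
  shows "norm x \<le> c"
proof (cases "x = 0")
  case False
  have "norm x * norm x \<le> c * norm x"
    using assms(1)[of x] by (simp add: power2_norm_eq_inner[symmetric] power2_eq_square)
  with False show ?thesis by simp
qed (use assms in simp)

lemma norm_adjoint_le:
  fixes F :: "'a::{real_inner,banach} \<Rightarrow> 'b::real_inner"
  assumes F: "bounded_linear F" and K: "\<And>x. norm (F x) \<le> K * norm x" "K \<ge> 0"
  shows "norm (adjoint F x) \<le> K * norm x"
proof (rule norm_le_if_inner_le)
  fix v
  have "\<bar>inner (F v) x\<bar> \<le> norm (F v) * norm x" by (rule Cauchy_Schwarz_ineq2)
  also have "\<dots> \<le> (K * norm v) * norm x" by (intro mult_right_mono K) simp
  finally show "\<bar>inner v (adjoint F x)\<bar> \<le> K * norm x * norm v"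
    by (simp add: inner_adjoint[OF F] mult_ac)
qed (use K in simp)

lemma bounded_linear_adjoint:
  fixes F :: "'a::{real_inner,banach} \<Rightarrow> 'b::real_inner"
  assumes F: "bounded_linear F"
  shows "bounded_linear (adjoint F)"
proof -
  obtain K where K: "\<And>x. norm (F x) \<le> norm x * K" "K \<ge> 0"
    using bounded_linear.nonneg_bounded[OF F] by blast
  show ?thesis
  proof (rule bounded_linear_intro[where K = K])
    show "adjoint F (x + y) = adjoint F x + adjoint F y" for x y
      by (rule eq_if_inner_eq) (simp add: inner_adjoint[OF F, symmetric] inner_add_right)
    show "adjoint F (c *\<^sub>R x) = c *\<^sub>R adjoint F x" for c x
      by (rule eq_if_inner_eq) (simp add: inner_adjoint[OF F, symmetric])
    show "norm (adjoint F x) \<le> norm x * K" for x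
      using norm_adjoint_le[OF F, of K x] K by (simp add: mult.commute)
  qed
qed

text \<open>
  For small \<open>\<rho> > 0\<close> coercivity makes \<open>x \<mapsto> x - \<rho> (Q x - y)\<close> a contraction, whose fixed point
  solves \<open>Q x = y\<close>.
\<close>

lemma Lax_Milgram:
  fixes Q :: "'a::{real_inner,banach} \<Rightarrow> 'a"
  assumes Q: "bounded_linear Q"
    and c: "c > 0" "\<And>x. c * (norm x)\<^sup>2 \<le> inner (Q x) x"
  shows "\<exists>x. Q x = y"
proof -
  interpret bounded_linear Q by fact
  obtain K where K: "K > 0" "\<And>x. norm (Q x) \<le> norm x * K"
    using pos_bounded by blast
  define L where "L = K + c"
  have L: "L > 0" "c \<le> L" using K c by (auto simp: L_def)
  have LQ: "norm (Q x) \<le> norm x * L" for x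
  proof -
    have "0 \<le> norm x * c" using c by simp
    with K(2)[of x] show ?thesis by (simp add: L_def distrib_left)
  qed
  \<comment> \<open>This \<open>\<rho>\<close> minimizes the bound \<open>1 - 2 \<rho> c + \<rho>\<^sup>2 L\<^sup>2\<close>; the condition \<open>c \<le> L\<close> keeps the minimum nonnegative.\<close>
  define \<rho> where "\<rho> = c / L\<^sup>2"
  define q where "q = sqrt (1 - c\<^sup>2 / L\<^sup>2)"
  have q0: "0 < c\<^sup>2 / L\<^sup>2" "c\<^sup>2 / L\<^sup>2 \<le> 1" using c L by (auto simp: power_mono)
  have q: "0 \<le> q" "q < 1" "q\<^sup>2 = 1 - c\<^sup>2 / L\<^sup>2"
    using q0 unfolding q_def by auto
  have contr: "norm (x - \<rho> *\<^sub>R Q x) \<le> q * norm x" for x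
  proof -
    have "(norm (x - \<rho> *\<^sub>R Q x))\<^sup>2 = (norm x)\<^sup>2 - 2 * \<rho> * inner (Q x) x + \<rho>\<^sup>2 * (norm (Q x))\<^sup>2"
      unfolding power2_norm_eq_inner
      by (simp add: inner_diff_left inner_diff_right inner_commute algebra_simps power2_eq_square)
    also have "\<dots> \<le> (norm x)\<^sup>2 - 2 * \<rho> * (c * (norm x)\<^sup>2) + \<rho>\<^sup>2 * (norm x * L)\<^sup>2"
      using c L LQ by (intro add_mono diff_mono mult_left_mono power_mono) (auto simp: \<rho>_def)
    also have "\<dots> = (norm x)\<^sup>2 * (1 - 2 * \<rho> * c + \<rho>\<^sup>2 * L\<^sup>2)"
      by (simp add: power_mult_distrib algebra_simps)
    also have "1 - 2 * \<rho> * c + \<rho>\<^sup>2 * L\<^sup>2 = q\<^sup>2"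
      unfolding q(3) using L by (simp add: \<rho>_def power2_eq_square)
    finally have "(norm (x - \<rho> *\<^sub>R Q x))\<^sup>2 \<le> (q * norm x)\<^sup>2"
      by (simp add: power_mult_distrib mult_ac)
    then show ?thesis using q by (auto intro: power2_le_imp_le)
  qed
  have "\<exists>!x. x - \<rho> *\<^sub>R (Q x - y) = x"
  proof (rule banach_fix_type[OF q(1,2)], intro allI)
    fix x z
    have "(x - \<rho> *\<^sub>R (Q x - y)) - (z - \<rho> *\<^sub>R (Q z - y)) = (x - z) - \<rho> *\<^sub>R Q (x - z)"
      by (simp add: diff algebra_simps)
    with contr[of "x - z"]
    show "dist (x - \<rho> *\<^sub>R (Q x - y)) (z - \<rho> *\<^sub>R (Q z - y)) \<le> q * dist x z"
      by (simp only: dist_norm)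
  qed
  then obtain x where "x - \<rho> *\<^sub>R (Q x - y) = x" by blast
  moreover have "\<rho> \<noteq> 0" using c L by (simp add: \<rho>_def)
  ultimately show ?thesis by auto
qed

text \<open>
  The Banach-Steinhaus theorem for sequences: by Baire, one of the closed sets on which the whole
  sequence is bounded by \<open>k\<close> contains a ball, and linearity moves the bound on that ball to the origin.
\<close>

lemma uniform_boundedness:
  fixes F :: "nat \<Rightarrow> 'a::banach \<Rightarrow> 'b::real_normed_vector"
  assumes lin: "\<And>n. bounded_linear (F n)"
    and bdd: "\<And>x. \<exists>c. \<forall>n. norm (F n x) \<le> c"
  shows "\<exists>K\<ge>0. \<forall>n x. norm (F n x) \<le> K * norm x"
proof -
  define E where "E k = {x. \<forall>n. norm (F n x) \<le> real k}" for k :: nat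
  have cl: "closed (E k)" for k
  proof -
    have "E k = (\<Inter>n. {x. norm (F n x) \<le> real k})" by (auto simp: E_def)
    moreover have "closed {x. norm (F n x) \<le> real k}" for n
      by (intro closed_Collect_le continuous_intros bounded_linear.continuous_on[OF lin] continuous_on_id)
    ultimately show ?thesis by auto
  qed
  have cover: "\<Union>(range E) = UNIV"
  proof -
    have "\<exists>k. x \<in> E k" for x
    proof -
      obtain c where c: "\<And>n. norm (F n x) \<le> c" using bdd by blast
      obtain k where "c \<le> real k" using real_arch_simple by blast
      with c show ?thesis unfolding E_def using order_trans by blast
    qed
    then show ?thesis by blast
  qed
  have "\<exists>k. interior (E k) \<noteq> {}"
  proof (rule ccontr)
    assume "\<not> (\<exists>k. interior (E k) \<noteq> {})"
    then have "(euclidean :: 'a topology) interior_of \<Union>(range E) = {}"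
      by (intro Baire_category_alt) (use cl completely_metrizable_space_euclidean in auto)
    with cover show False by simp
  qed
  then obtain k x0 where "x0 \<in> interior (E k)" by blast
  then obtain r where r: "r > 0" "ball x0 r \<subseteq> E k" by (auto simp: mem_interior)
  have "norm (F n x) \<le> (4 * real k / r) * norm x" for n x
  proof (cases "x = 0")
    case True
    then show ?thesis by (simp add: linear_simps(3)[OF lin])
  next
    case False
    define t where "t = r / (2 * norm x)"
    have t: "t > 0" using r False by (simp add: t_def)
    have "x0 + t *\<^sub>R x \<in> E k" "x0 \<in> E k"
      using r False by (auto intro!: subsetD[OF r(2)] simp: dist_norm t_def)
    then have "norm (F n (x0 + t *\<^sub>R x) - F n x0) \<le> real k + real k"
      unfolding E_def by (intro order_trans[OF norm_triangle_ineq4] add_mono) auto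
    moreover have "F n (x0 + t *\<^sub>R x) - F n x0 = t *\<^sub>R F n x"
      using lin[of n] by (simp add: linear_simps)
    ultimately have "t * norm (F n x) \<le> 2 * real k" using t by simp
    then show ?thesis using r False by (simp add: t_def field_simps)
  qed
  then show ?thesis using r by (intro exI[of _ "4 * real k / r"]) auto
qed

section \<open>Strongly continuous semigroups\<close>

lemma C0_semigroupD:
  assumes "C0_semigroup S"
  shows "t \<ge> 0 \<Longrightarrow> bounded_linear (S t)" "S 0 x = x"
    "s \<ge> 0 \<Longrightarrow> t \<ge> 0 \<Longrightarrow> S (s + t) x = S s (S t x)"
    "((\<lambda>t. S t x) \<longlongrightarrow> x) (at_right 0)"
  using assms unfolding C0_semigroup_def by auto

lemma C0_semigroup_near_zero:
  assumes S: "C0_semigroup S" and e: "e > 0"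
  shows "\<exists>d>0. \<forall>t. 0 \<le> t \<and> t < d \<longrightarrow> norm (S t x - x) < e"
proof -
  have "eventually (\<lambda>t. dist (S t x) x < e) (at_right 0)"
    using C0_semigroupD(4)[OF S, of x] e tendstoD by blast
  then obtain d where d: "d > 0" "\<And>t. 0 < t \<Longrightarrow> t < d \<Longrightarrow> dist (S t x) x < e"
    by (auto simp: eventually_at_right_field)
  have "norm (S t x - x) < e" if "0 \<le> t" "t < d" for t
    using d(2)[of t] that e C0_semigroupD(2)[OF S, of x]
    by (cases "t = 0") (auto simp: dist_norm)
  with d(1) show ?thesis by blast
qed

text \<open>
  Otherwise there are times \<open>t\<^sub>n \<rightarrow> 0\<close> along which the operator norms are unbounded, although each orbit
  \<open>S (t\<^sub>n) y\<close> converges to \<open>y\<close>; this contradicts uniform boundedness.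
\<close>

lemma C0_semigroup_bounded_near_zero:
  fixes S :: "real \<Rightarrow> 'h \<Rightarrow> 'h::banach"
  assumes S: "C0_semigroup S"
  shows "\<exists>d>0. \<exists>K\<ge>1. \<forall>t\<in>{0..d}. \<forall>x. norm (S t x) \<le> K * norm x"
proof (rule ccontr)
  assume "\<not> ?thesis"
  then have *: "\<exists>t\<in>{0..d}. \<exists>x. norm (S t x) > K * norm x" if "d > 0" "K \<ge> 1" for d K
    using that by (meson linorder_not_le)
  have "\<exists>t x. 0 \<le> t \<and> t \<le> 1 / real (Suc n) \<and> norm (S t x) > real (Suc n) * norm x" for n
    using *[of "1 / real (Suc n)" "real (Suc n)"] by fastforce
  then obtain t x where tx: "\<And>n. 0 \<le> t n" "\<And>n. t n \<le> 1 / real (Suc n)"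
      "\<And>n. norm (S (t n) (x n)) > real (Suc n) * norm (x n)"
    by metis
  have t0: "t \<longlonglongrightarrow> 0"
    by (rule tendsto_sandwich[OF _ _ tendsto_const LIMSEQ_inverse_real_of_nat])
       (use tx(1,2) in \<open>auto simp: inverse_eq_divide\<close>)
  have "\<exists>c. \<forall>n. norm (S (t n) y) \<le> c" for y
  proof -
    have "(\<lambda>n. S (t n) y) \<longlonglongrightarrow> y"
    proof (rule tendstoI)
      fix e :: real assume "e > 0"
      then obtain d where d: "d > 0" "\<And>t. 0 \<le> t \<and> t < d \<Longrightarrow> norm (S t y - y) < e"
        using C0_semigroup_near_zero[OF S] by blast
      have "eventually (\<lambda>n. t n < d) sequentially"
        using t0 d(1) by (auto dest: order_tendstoD)
      then show "eventually (\<lambda>n. dist (S (t n) y) y < e) sequentially"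
        by eventually_elim (use d(2) tx(1) in \<open>auto simp: dist_norm\<close>)
    qed
    then have "Bseq (\<lambda>n. S (t n) y)" by (rule convergent_imp_Bseq[OF convergentI])
    then show ?thesis by (auto simp: Bseq_def)
  qed
  then obtain K where K: "\<And>n x. norm (S (t n) x) \<le> K * norm x"
    using uniform_boundedness[of "\<lambda>n. S (t n)"] C0_semigroupD(1)[OF S] tx(1) by blast
  obtain n where "K \<le> real n" using real_arch_simple by blast
  then have "K * norm (x n) \<le> real (Suc n) * norm (x n)" by (intro mult_right_mono) auto
  with K[of n "x n"] tx(3)[of n] show False by linarith
qed

lemma C0_semigroup_bounded:
  fixes S :: "real \<Rightarrow> 'h \<Rightarrow> 'h::banach"
  assumes S: "C0_semigroup S"
  shows "\<exists>M\<ge>0. \<forall>t\<in>{0..T}. \<forall>x. norm (S t x) \<le> M * norm x"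
proof -
  obtain d K where d: "d > 0" and K: "K \<ge> 1"
    and dK: "\<And>t x. t \<in> {0..d} \<Longrightarrow> norm (S t x) \<le> K * norm x"
    using C0_semigroup_bounded_near_zero[OF S] by blast
  have *: "norm (S t x) \<le> K ^ Suc k * norm x" if "t \<in> {0..real (Suc k) * d}" for t x k
    using that
  proof (induction k arbitrary: t)
    case (Suc k)
    show ?case
    proof (cases "t \<le> d")
      case True
      then have "norm (S t x) \<le> K * norm x" using dK Suc.prems by auto
      also have "\<dots> \<le> K ^ Suc (Suc k) * norm x"
        using K power_increasing[of 1 "Suc (Suc k)" K] by (intro mult_right_mono) auto
      finally show ?thesis .
    next
      case False
      have "S t x = S d (S (t - d) x)"
        using C0_semigroupD(3)[OF S, of d "t - d" x] False d by simp
      then have "norm (S t x) \<le> K * norm (S (t - d) x)" using dK d by simp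
      also have "\<dots> \<le> K * (K ^ Suc k * norm x)"
        using Suc.prems False K by (intro mult_left_mono Suc.IH) (auto simp: algebra_simps)
      finally show ?thesis by (simp add: mult_ac)
    qed
  qed (use dK in simp)
  obtain k where "T / d \<le> real k" using real_arch_simple by blast
  then have "T \<le> real (Suc k) * d" using d by (simp add: field_simps)
  then have "\<forall>t\<in>{0..T}. \<forall>x. norm (S t x) \<le> K ^ Suc k * norm x"
    by (intro ballI allI *) auto
  then show ?thesis using K by (intro exI[of _ "K ^ Suc k"]) auto
qed

text \<open>
  The clipping \<open>max 0\<close> extends the semigroup constantly to negative times, where \<open>S\<close> is arbitrary, so
  that continuity can be stated on the whole space and composed without side conditions on times.
\<close>

lemma C0_semigroup_jointly_continuous:
  fixes S :: "real \<Rightarrow> 'h \<Rightarrow> 'h::banach"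
  assumes S: "C0_semigroup S"
  shows "continuous_on UNIV (\<lambda>p. S (max 0 (fst p)) (snd p))"
  unfolding continuous_on_iff
proof (intro ballI allI impI)
  fix p :: "real \<times> 'h" and e :: real
  assume e: "e > 0"
  define \<tau>0 x0 where "\<tau>0 = max 0 (fst p)" and "x0 = snd p"
  obtain M where M0: "M \<ge> 0" and M: "\<And>t x. t \<in> {0..\<tau>0 + 1} \<Longrightarrow> norm (S t x) \<le> M * norm x"
    using C0_semigroup_bounded[OF S] by blast
  define e' where "e' = e / (2 * (M + 1))"
  have e': "e' > 0" using e M0 by (simp add: e'_def)
  obtain d where d: "d > 0" "\<And>t. 0 \<le> t \<and> t < d \<Longrightarrow> norm (S t x0 - x0) < e'"
    using C0_semigroup_near_zero[OF S e'] by blast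
  show "\<exists>d>0. \<forall>q\<in>UNIV. dist q p < d \<longrightarrow> dist (S (max 0 (fst q)) (snd q)) (S (max 0 (fst p)) (snd p)) < e"
  proof (intro exI conjI ballI impI)
    show "min (min d 1) e' > 0" using d e' by simp
    fix q :: "real \<times> 'h" assume q: "dist q p < min (min d 1) e'"
    define \<tau> x where "\<tau> = max 0 (fst q)" and "x = snd q"
    have "dist (fst q) (fst p) < min (min d 1) e'" using dist_fst_le[of q p] q by linarith
    then have \<tau>: "\<bar>\<tau> - \<tau>0\<bar> < d" "\<bar>\<tau> - \<tau>0\<bar> < 1" "\<tau> \<ge> 0" "\<tau>0 \<ge> 0"
      unfolding \<tau>_def \<tau>0_def dist_real_def by auto
    have x: "norm (x - x0) < e'"
      using dist_snd_le[of q p] q by (simp add: x_def x0_def dist_norm)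
    have 1: "norm (S \<tau> x - S \<tau> x0) \<le> M * norm (x - x0)"
    proof -
      have "S \<tau> x - S \<tau> x0 = S \<tau> (x - x0)"
        using C0_semigroupD(1)[OF S \<tau>(3)] by (simp add: linear_simps)
      then show ?thesis using M[of \<tau> "x - x0"] \<tau> by simp
    qed
    have 2: "norm (S \<tau> x0 - S \<tau>0 x0) \<le> M * norm (S \<bar>\<tau> - \<tau>0\<bar> x0 - x0)"
    proof (cases "\<tau> \<le> \<tau>0")
      case True
      have "S \<tau>0 x0 = S \<tau> (S (\<tau>0 - \<tau>) x0)"
        using C0_semigroupD(3)[OF S, of \<tau> "\<tau>0 - \<tau>" x0] True \<tau> by simp
      then have "norm (S \<tau> x0 - S \<tau>0 x0) = norm (S \<tau> (x0 - S (\<tau>0 - \<tau>) x0))"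
        using C0_semigroupD(1)[OF S \<tau>(3)] by (simp add: linear_simps)
      then show ?thesis using M[of \<tau> "x0 - S (\<tau>0 - \<tau>) x0"] \<tau> True
        by (simp add: norm_minus_commute)
    next
      case False
      have "S \<tau> x0 = S \<tau>0 (S (\<tau> - \<tau>0) x0)"
        using C0_semigroupD(3)[OF S, of \<tau>0 "\<tau> - \<tau>0" x0] False \<tau> by simp
      then have "norm (S \<tau> x0 - S \<tau>0 x0) = norm (S \<tau>0 (S (\<tau> - \<tau>0) x0 - x0))"
        using C0_semigroupD(1)[OF S \<tau>(4)] by (simp add: linear_simps)
      then show ?thesis using M[of \<tau>0 "S (\<tau> - \<tau>0) x0 - x0"] \<tau> False by simp
    qed
    have "norm (S \<tau> x - S \<tau>0 x0) \<le> norm (S \<tau> x - S \<tau> x0) + norm (S \<tau> x0 - S \<tau>0 x0)"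
      by (rule norm_diff_triangle_ineq[of _ "S \<tau> x0" "S \<tau> x0", simplified])
    also have "\<dots> \<le> M * e' + M * e'"
    proof (intro add_mono)
      show "norm (S \<tau> x - S \<tau> x0) \<le> M * e'"
        using 1 x M0 by (meson less_imp_le mult_left_mono order_trans)
      show "norm (S \<tau> x0 - S \<tau>0 x0) \<le> M * e'"
        using 2 d(2)[of "\<bar>\<tau> - \<tau>0\<bar>"] \<tau> M0 by (meson abs_ge_zero less_imp_le mult_left_mono order_trans)
    qed
    also have "\<dots> = e * (M / (M + 1))" using M0 by (simp add: e'_def divide_simps)
    also have "\<dots> < e * 1" using e M0 by (intro mult_strict_left_mono) auto
    also have "\<dots> = e" by simp
    finally show "dist (S (max 0 (fst q)) (snd q)) (S (max 0 (fst p)) (snd p)) < e"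
      by (simp add: dist_norm \<tau>_def x_def \<tau>0_def x0_def)
  qed
qed

lemma C0_semigroup_continuous_compose:
  fixes S :: "real \<Rightarrow> 'h \<Rightarrow> 'h::banach"
  assumes S: "C0_semigroup S" and "continuous_on X f" "continuous_on X g"
  shows "continuous_on X (\<lambda>s. S (max 0 (f s)) (g s))"
  using continuous_on_compose2[OF C0_semigroup_jointly_continuous[OF S] continuous_on_Pair[OF assms(2,3)]]
  by simp

lemma average_tendsto:
  fixes \<phi> :: "real \<Rightarrow> 'a::banach"
  assumes c: "continuous_on UNIV \<phi>"
  shows "((\<lambda>t. (1 / t) *\<^sub>R integral {a..a + t} \<phi>) \<longlongrightarrow> \<phi> a) (at_right 0)"
proof (rule tendstoI)
  fix e :: real assume e: "e > 0"
  obtain d where d: "d > 0" "\<And>s. dist s a < d \<Longrightarrow> dist (\<phi> s) (\<phi> a) < e / 2"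
    using c e unfolding continuous_on_iff by (metis UNIV_I half_gt_zero)
  have "dist ((1 / t) *\<^sub>R integral {a..a + t} \<phi>) (\<phi> a) < e" if t: "0 < t" "t < d" for t
  proof -
    have int: "\<phi> integrable_on {a..a + t}"
      using c continuous_on_subset by (intro integrable_continuous_real) blast
    have "integral {a..a + t} (\<lambda>s. \<phi> s - \<phi> a) = integral {a..a + t} \<phi> - t *\<^sub>R \<phi> a"
      using t int by (subst integral_diff) auto
    moreover have "norm (integral {a..a + t} (\<lambda>s. \<phi> s - \<phi> a)) \<le> e / 2 * (a + t - a)"
    proof (rule integral_bound)
      show "continuous_on {a..a + t} (\<lambda>s. \<phi> s - \<phi> a)"
        using c continuous_on_subset by (intro continuous_intros) blast
      show "norm (\<phi> s - \<phi> a) \<le> e / 2" if "s \<in> {a..a + t}" for s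
        using t d(2)[of s] that by (auto simp: dist_norm intro!: less_imp_le)
    qed (use t in simp)
    moreover have "(1 / t) *\<^sub>R integral {a..a + t} \<phi> - \<phi> a
        = (1 / t) *\<^sub>R (integral {a..a + t} \<phi> - t *\<^sub>R \<phi> a)"
      using t by (simp add: scaleR_diff_right)
    ultimately have "norm ((1 / t) *\<^sub>R integral {a..a + t} \<phi> - \<phi> a) \<le> (1 / t) * (e / 2 * t)"
      using t by (simp only: norm_scaleR) (intro mult_mono, auto)
    then have "norm ((1 / t) *\<^sub>R integral {a..a + t} \<phi> - \<phi> a) \<le> e / 2"
      using t by simp
    then show ?thesis using e by (simp add: dist_norm)
  qed
  then show "eventually (\<lambda>t. dist ((1 / t) *\<^sub>R integral {a..a + t} \<phi>) (\<phi> a) < e) (at_right 0)"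
    using d(1) by (auto simp: eventually_at_right_field)
qed

text \<open>
  The telescoping identity behind both the generator of a semigroup and the continuity of its adjoint:
  shifting the integrand changes the integral only near the two end points.
\<close>

lemma integral_shift_diff:
  fixes \<phi> :: "real \<Rightarrow> 'a::banach"
  assumes c: "continuous_on UNIV \<phi>" and "r \<ge> 0" "t \<ge> 0"
  shows "integral {0..r} (\<lambda>s. \<phi> (s + t)) - integral {0..r} \<phi>
    = integral {r..r + t} \<phi> - integral {0..t} \<phi>"
proof -
  have int: "\<phi> integrable_on {a..b}" for a b
    using c continuous_on_subset by (intro integrable_continuous_real) blast
  have "integral {0..r} (\<lambda>s. \<phi> (s + t)) = integral {t..r + t} \<phi>"
    using integral_shift_Icc_real[of 0 r \<phi> t] by (simp add: o_def add.commute)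
  moreover have "integral {0..t} \<phi> + integral {t..r + t} \<phi> = integral {0..r + t} \<phi>"
    using assms int by (intro Henstock_Kurzweil_Integration.integral_combine) auto
  moreover have "integral {0..r} \<phi> + integral {r..r + t} \<phi> = integral {0..r + t} \<phi>"
    using assms int by (intro Henstock_Kurzweil_Integration.integral_combine) auto
  ultimately show ?thesis by (simp add: algebra_simps)
qed

lemma inner_integral_left:
  fixes f :: "'n::euclidean_space \<Rightarrow> 'a::{real_inner,banach}"
  assumes "f integrable_on X"
  shows "inner (integral X f) v = integral X (\<lambda>s. inner (f s) v)"
  using integral_linear[OF assms bounded_linear_inner_left[of v]] by (simp add: o_def)

lemma inner_integral_right:
  fixes f :: "'n::euclidean_space \<Rightarrow> 'a::{real_inner,banach}"
  assumes "f integrable_on X"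
  shows "inner v (integral X f) = integral X (\<lambda>s. inner v (f s))"
  using inner_integral_left[OF assms, of v] by (simp add: inner_commute)

text \<open>
  Integrated orbits of arbitrary vectors lie in the domain of the generator. They are the test vectors
  with which the generator of the adjoint semigroup is computed.
\<close>

lemma integral_orbit_in_generator:
  fixes S :: "real \<Rightarrow> 'h \<Rightarrow> 'h::banach"
  assumes S: "C0_semigroup S" and t: "t \<ge> 0"
  shows "(integral {0..t} (\<lambda>s. S (max 0 s) u), S t u - u) \<in> generator S"
proof -
  let ?\<phi> = "\<lambda>s. S (max 0 s) u"
  have c: "continuous_on UNIV ?\<phi>"
    by (intro C0_semigroup_continuous_compose[OF S] continuous_intros)
  have eq: "S h (integral {0..t} ?\<phi>) - integral {0..t} ?\<phi> = integral {t..t + h} ?\<phi> - integral {0..h} ?\<phi>"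
    if h: "h > 0" for h
  proof -
    have "?\<phi> integrable_on {0..t}"
      using c continuous_on_subset by (intro integrable_continuous_real) blast
    then have "S h (integral {0..t} ?\<phi>) = integral {0..t} (\<lambda>s. S h (?\<phi> s))"
      using integral_linear[of ?\<phi> "{0..t}" "S h"] C0_semigroupD(1)[OF S] h by (simp add: o_def)
    also have "\<dots> = integral {0..t} (\<lambda>s. ?\<phi> (s + h))"
    proof (rule integral_cong)
      fix s assume "s \<in> {0..t}"
      then show "S h (?\<phi> s) = ?\<phi> (s + h)"
        using C0_semigroupD(3)[OF S, of h s u] h by (simp add: add.commute)
    qed
    finally show ?thesis using integral_shift_diff[OF c t, of h] h by simp
  qed
  have "((\<lambda>h. (1 / h) *\<^sub>R integral {t..t + h} ?\<phi> - (1 / h) *\<^sub>R integral {0..0 + h} ?\<phi>)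
      \<longlongrightarrow> ?\<phi> t - ?\<phi> 0) (at_right 0)"
    by (intro tendsto_diff average_tendsto c)
  moreover have "eventually (\<lambda>h. (1 / h) *\<^sub>R integral {t..t + h} ?\<phi> - (1 / h) *\<^sub>R integral {0..0 + h} ?\<phi>
      = (1 / h) *\<^sub>R (S h (integral {0..t} ?\<phi>) - integral {0..t} ?\<phi>)) (at_right 0)"
    using eq by (auto simp: eventually_at_right_field simp flip: scaleR_diff_right intro!: exI[of _ 1])
  ultimately have "((\<lambda>h. (1 / h) *\<^sub>R (S h (integral {0..t} ?\<phi>) - integral {0..t} ?\<phi>))
      \<longlongrightarrow> ?\<phi> t - ?\<phi> 0) (at_right 0)"
    by (rule Lim_transform_eventually)
  then show ?thesis using t C0_semigroupD(2)[OF S] by (simp add: generator_def max_def)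
qed

section \<open>The adjoint semigroup\<close>

text \<open>
  The vector is \<open>\<integral>\<^sub>0\<^sup>r S\<^sup>*(s) x ds\<close>. It is defined weakly because the strong continuity of \<open>S\<^sup>*\<close>, and hence
  the existence of this integral, is not known yet.
\<close>

lemma adjoint_semigroup_weak_average:
  fixes S :: "real \<Rightarrow> 'h \<Rightarrow> 'h::{real_inner,banach}"
  assumes S: "C0_semigroup S" and r: "r \<ge> 0"
  shows "\<exists>xr. \<forall>u. inner u xr = integral {0..r} (\<lambda>s. inner (S (max 0 s) u) x)"
proof -
  obtain M where M0: "M \<ge> 0" and M: "\<And>t x. t \<in> {0..r} \<Longrightarrow> norm (S t x) \<le> M * norm x"
    using C0_semigroup_bounded[OF S] by blast
  let ?f = "\<lambda>u. integral {0..r} (\<lambda>s. inner (S (max 0 s) u) x)"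
  have c: "continuous_on X (\<lambda>s. inner (S (max 0 s) u) x)" for u X
    by (intro C0_semigroup_continuous_compose[OF S] continuous_intros)
  have int: "(\<lambda>s. inner (S (max 0 s) u) x) integrable_on {0..r}" for u
    by (intro integrable_continuous_real c)
  have lin: "linear (S (max 0 s))" for s
    using C0_semigroupD(1)[OF S] by (simp add: bounded_linear.linear)
  have "bounded_linear ?f"
  proof (rule bounded_linear_intro)
    show "?f (u + v) = ?f u + ?f v" for u v
      by (simp add: linear_add[OF lin] inner_add_left integral_add int)
    show "?f (k *\<^sub>R u) = k *\<^sub>R ?f u" for k u
      by (simp add: linear_scale[OF lin])
    show "norm (?f u) \<le> norm u * (M * norm x * r)" for u
    proof -
      have "norm (?f u) \<le> (M * norm u * norm x) * (r - 0)"
      proof (rule integral_bound[OF r c])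
        fix s assume s: "s \<in> {0..r}"
        have "\<bar>inner (S s u) x\<bar> \<le> norm (S s u) * norm x" by (rule Cauchy_Schwarz_ineq2)
        also have "\<dots> \<le> M * norm u * norm x" using M s by (intro mult_right_mono) auto
        finally show "norm (inner (S (max 0 s) u) x) \<le> M * norm u * norm x" using s by simp
      qed
      then show ?thesis by (simp add: mult_ac)
    qed
  qed
  from Riesz_representation[OF this] show ?thesis by auto
qed

text \<open>
  Only strong continuity at \<open>0\<close> is not immediate. The vectors \<open>x\<close> with \<open>S\<^sup>*(t) x \<rightarrow> x\<close> form a closed
  subspace \<open>E\<close> by the local bound. The weak averages \<open>\<integral>\<^sub>0\<^sup>r S\<^sup>*(s) x ds\<close> belong to \<open>E\<close>, since shifting them
  by \<open>t\<close> changes them by \<open>O(t)\<close> in norm. A vector \<open>v\<close> orthogonal to all of them satisfies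
  \<open>\<integral>\<^sub>0\<^sup>r \<langle>S(s) v, x\<rangle> ds = 0\<close> for all small \<open>r\<close>, hence \<open>\<langle>v, x\<rangle> = 0\<close>, for every \<open>x\<close>. So \<open>E\<close> is everything.
\<close>

lemma C0_semigroup_adjoint:
  fixes S :: "real \<Rightarrow> 'h \<Rightarrow> 'h::{real_inner,banach}"
  assumes S: "C0_semigroup S"
  shows "C0_semigroup (\<lambda>t. adjoint (S t))"
proof -
  let ?R = "\<lambda>t. adjoint (S t)"
  note bl = C0_semigroupD(1)[OF S]
  have R_inner: "inner u (?R t x) = inner (S t u) x" if "t \<ge> 0" for u x t
    using inner_adjoint[OF bl[OF that], of u x] by simp
  obtain M where M0: "M \<ge> 0" and M: "\<And>t x. t \<in> {0..2} \<Longrightarrow> norm (S t x) \<le> M * norm x"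
    using C0_semigroup_bounded[OF S] by blast
  have RM: "norm (?R t x) \<le> M * norm x" if "t \<in> {0..2}" for t x
    using that by (intro norm_adjoint_le bl M M0) auto
  define E where "E = {x. ((\<lambda>t. ?R t x) \<longlongrightarrow> x) (at_right 0)}"
  have ev: "eventually (\<lambda>t::real. 0 < t \<and> t < 1) (at_right 0)"
    by (auto simp: eventually_at_right_field intro!: exI[of _ 1])
  have sub: "subspace E"
    unfolding subspace_def
  proof (intro conjI ballI allI)
    show "0 \<in> E"
      unfolding E_def mem_Collect_eq
      by (rule Lim_transform_eventually[OF tendsto_const], rule eventually_mono[OF ev])
         (simp add: linear_simps bounded_linear_adjoint bl)
    show "x + y \<in> E" if "x \<in> E" "y \<in> E" for x y
    proof -
      have "((\<lambda>t. ?R t x + ?R t y) \<longlongrightarrow> x + y) (at_right 0)"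
        using that by (auto simp: E_def intro: tendsto_add)
      then show ?thesis unfolding E_def mem_Collect_eq
        by (rule Lim_transform_eventually, intro eventually_mono[OF ev])
           (simp add: linear_simps bounded_linear_adjoint bl)
    qed
    show "c *\<^sub>R x \<in> E" if "x \<in> E" for c x
    proof -
      have "((\<lambda>t. c *\<^sub>R ?R t x) \<longlongrightarrow> c *\<^sub>R x) (at_right 0)"
        using that by (auto simp: E_def intro!: tendsto_intros)
      then show ?thesis unfolding E_def mem_Collect_eq
        by (rule Lim_transform_eventually, intro eventually_mono[OF ev])
           (simp add: linear_simps bounded_linear_adjoint bl)
    qed
  qed
  have cl: "closed E"
    unfolding closed_sequential_limits
  proof (intro allI impI, elim conjE)
    fix X x assume X: "\<forall>n. X n \<in> E" "X \<longlonglongrightarrow> x"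
    show "x \<in> E" unfolding E_def mem_Collect_eq
    proof (rule tendstoI)
      fix e :: real assume e: "e > 0"
      define e' where "e' = e / (M + 2)"
      have e': "e' > 0" using e M0 by (simp add: e'_def)
      obtain n where n: "norm (x - X n) < e'"
        using X(2) e' by (metis LIMSEQ_iff_nz dist_commute dist_norm lim_sequentially order_refl)
      have "eventually (\<lambda>t. dist (?R t (X n)) (X n) < e') (at_right 0)"
        using X(1) e' tendstoD unfolding E_def by blast
      with ev show "eventually (\<lambda>t. dist (?R t x) x < e) (at_right 0)"
      proof eventually_elim
        case (elim t)
        have "?R t x - x = ?R t (x - X n) + (?R t (X n) - X n) + (X n - x)"
          using elim by (simp add: linear_simps bounded_linear_adjoint bl)
        then have "norm (?R t x - x) \<le> norm (?R t (x - X n)) + norm (?R t (X n) - X n) + norm (X n - x)"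
          by (simp only:) (intro norm_triangle_le add_right_mono norm_triangle_ineq)
        moreover have "norm (?R t (x - X n)) \<le> M * norm (x - X n)" using RM elim by simp
        moreover have "M * norm (x - X n) \<le> M * e'" using n M0 by (intro mult_left_mono) auto
        ultimately have "norm (?R t x - x) < M * e' + e' + e'"
          using elim n by (simp add: dist_norm norm_minus_commute)
        also have "\<dots> = e' * (M + 2)" by (simp add: algebra_simps)
        also have "\<dots> = e" using M0 by (simp add: e'_def)
        finally show ?case by (simp add: dist_norm)
      qed
    qed
  qed
  have "E = UNIV"
  proof (rule closed_subspace_eq_UNIV[OF sub cl])
    fix v assume orth: "\<And>e. e \<in> E \<Longrightarrow> inner v e = 0"
    have c: "continuous_on UNIV (\<lambda>s. inner (S (max 0 s) u) x)" for u x
      by (intro C0_semigroup_continuous_compose[OF S] continuous_intros)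
    have zero: "integral {0..r} (\<lambda>s. inner (S (max 0 s) v) x) = 0" if r: "0 < r" "r < 1" for r x
    proof -
      obtain xr where xr: "\<And>u. inner u xr = integral {0..r} (\<lambda>s. inner (S (max 0 s) u) x)"
        using adjoint_semigroup_weak_average[OF S, of r] r by (metis less_imp_le)
      have bound: "norm (?R t xr - xr) \<le> 2 * M * norm x * t" if t: "0 < t" "t < 1" for t
      proof (rule norm_le_if_inner_le)
        fix u
        let ?\<phi> = "\<lambda>s. inner (S (max 0 s) u) x"
        have \<phi>: "norm (integral {a..a + t} ?\<phi>) \<le> M * norm u * norm x * (a + t - a)" if a: "a \<in> {0..1}" for a
        proof (rule integral_bound)
          show "continuous_on {a..a + t} ?\<phi>" by (rule continuous_on_subset[OF c subset_UNIV])
          show "norm (?\<phi> s) \<le> M * norm u * norm x" if s: "s \<in> {a..a + t}" for s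
          proof -
            have "\<bar>inner (S s u) x\<bar> \<le> norm (S s u) * norm x" by (rule Cauchy_Schwarz_ineq2)
            also have "\<dots> \<le> M * norm u * norm x" using M s t a by (intro mult_right_mono) auto
            finally show ?thesis using s a by simp
          qed
        qed (use t in auto)
        have "inner u (?R t xr - xr) = inner (S t u) xr - inner u xr"
          using t by (simp add: inner_diff_right R_inner)
        also have "\<dots> = integral {0..r} (\<lambda>s. ?\<phi> (s + t)) - integral {0..r} ?\<phi>"
        proof -
          have "integral {0..r} (\<lambda>s. inner (S (max 0 s) (S t u)) x) = integral {0..r} (\<lambda>s. ?\<phi> (s + t))"
          proof (rule integral_cong)
            fix s assume "s \<in> {0..r}"
            then show "inner (S (max 0 s) (S t u)) x = ?\<phi> (s + t)"
              using C0_semigroupD(3)[OF S, of s t u] t by simp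
          qed
          then show ?thesis by (simp add: xr)
        qed
        also have "\<dots> = integral {r..r + t} ?\<phi> - integral {0..0 + t} ?\<phi>"
          using integral_shift_diff[OF c, of r t u x] r t by simp
        finally have "\<bar>inner u (?R t xr - xr)\<bar> \<le> norm (integral {r..r + t} ?\<phi>) + norm (integral {0..0 + t} ?\<phi>)"
          by simp
        also have "\<dots> \<le> M * norm u * norm x * t + M * norm u * norm x * t"
          using \<phi>[of r] \<phi>[of 0] r by (intro add_mono) auto
        finally show "\<bar>inner u (?R t xr - xr)\<bar> \<le> 2 * M * norm x * t * norm u"
          by (simp add: algebra_simps)
      qed (use M0 t in auto)
      have "((\<lambda>t. ?R t xr - xr) \<longlongrightarrow> 0) (at_right 0)"
      proof (rule Lim_null_comparison)
        show "eventually (\<lambda>t. norm (?R t xr - xr) \<le> 2 * M * norm x * t) (at_right 0)"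
          by (rule eventually_mono[OF ev]) (use bound in auto)
        show "((\<lambda>t::real. 2 * M * norm x * t) \<longlongrightarrow> 0) (at_right 0)"
          by (rule tendsto_eq_intros | simp)+
      qed
      then have "xr \<in> E" unfolding E_def by (simp add: LIM_zero_iff)
      from orth[OF this] show ?thesis by (simp add: xr)
    qed
    have "inner v x = 0" for x
    proof -
      let ?\<phi> = "\<lambda>s. inner (S (max 0 s) v) x"
      have "((\<lambda>t. (1 / t) *\<^sub>R integral {0..0 + t} ?\<phi>) \<longlongrightarrow> ?\<phi> 0) (at_right 0)"
        by (rule average_tendsto[OF c])
      moreover have "((\<lambda>t. (1 / t) *\<^sub>R integral {0..0 + t} ?\<phi>) \<longlongrightarrow> 0) (at_right 0)"
        by (rule Lim_transform_eventually[OF tendsto_const], rule eventually_mono[OF ev])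
           (use zero in auto)
      ultimately have "?\<phi> 0 = 0" by (rule tendsto_unique[rotated]) simp
      then show ?thesis by (simp add: C0_semigroupD(2)[OF S])
    qed
    then show "v = 0" by (metis inner_eq_zero_iff)
  qed
  then have cont: "((\<lambda>t. ?R t x) \<longlongrightarrow> x) (at_right 0)" for x by (auto simp: E_def)
  show ?thesis
    unfolding C0_semigroup_def
  proof (intro conjI allI impI)
    show "bounded_linear (?R t)" if "t \<ge> 0" for t using bl[OF that] by (rule bounded_linear_adjoint)
    show "?R 0 x = x" for x by (rule eq_if_inner_eq) (simp add: R_inner C0_semigroupD(2)[OF S])
    show "?R (s + t) x = ?R s (?R t x)" if st: "s \<ge> 0" "t \<ge> 0" for s t x
    proof (rule eq_if_inner_eq)
      fix u
      have "inner u (?R (s + t) x) = inner (S (t + s) u) x" using st by (simp add: R_inner add.commute)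
      also have "\<dots> = inner u (?R s (?R t x))" using st C0_semigroupD(3)[OF S] by (simp add: R_inner)
      finally show "inner u (?R (s + t) x) = inner u (?R s (?R t x))" .
    qed
  qed (rule cont)
qed

text \<open>
  For \<open>(x, y)\<close> in the graph of \<open>A\<^sup>*\<close>, testing with the integrated orbits shows
  \<open>S\<^sup>*(t) x - x = \<integral>\<^sub>0\<^sup>t S\<^sup>*(s) y ds\<close>, whose difference quotient tends to \<open>y\<close>. The other inclusion passes
  to the limit in \<open>\<langle>S(t) u - u, x\<rangle> = \<langle>u, S\<^sup>*(t) x - x\<rangle>\<close>.
\<close>

lemma generates_adjoint:
  fixes S :: "real \<Rightarrow> 'h \<Rightarrow> 'h::{real_inner,banach}"
  assumes gen: "generates A S"
  shows "generates (adjoint_op A) (\<lambda>t. adjoint (S t))"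
proof -
  have S: "C0_semigroup S" and A: "A = generator S" using gen by (auto simp: generates_def)
  let ?R = "\<lambda>t. adjoint (S t)"
  have R: "C0_semigroup ?R" by (rule C0_semigroup_adjoint[OF S])
  have R_inner: "inner u (?R t x) = inner (S t u) x" if "t \<ge> 0" for u x t
    using inner_adjoint[OF C0_semigroupD(1)[OF S that], of u x] by simp
  have ev: "eventually (\<lambda>t::real. 0 < t \<and> t < 1) (at_right 0)"
    by (auto simp: eventually_at_right_field intro!: exI[of _ 1])
  have "(x, y) \<in> generator ?R \<longleftrightarrow> (x, y) \<in> adjoint_op A" for x y
  proof
    assume xy: "(x, y) \<in> generator ?R"
    have "inner v x = inner u y" if uv: "(u, v) \<in> A" for u v
    proof -
      have "((\<lambda>t. inner ((1 / t) *\<^sub>R (S t u - u)) x) \<longlongrightarrow> inner v x) (at_right 0)"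
        using uv by (intro tendsto_inner tendsto_const) (simp add: A generator_def)
      moreover have "((\<lambda>t. inner u ((1 / t) *\<^sub>R (?R t x - x))) \<longlongrightarrow> inner u y) (at_right 0)"
        using xy by (intro tendsto_inner tendsto_const) (simp add: generator_def)
      then have "((\<lambda>t. inner ((1 / t) *\<^sub>R (S t u - u)) x) \<longlongrightarrow> inner u y) (at_right 0)"
        by (rule Lim_transform_eventually, intro eventually_mono[OF ev])
           (simp add: inner_diff_left inner_diff_right R_inner)
      ultimately show ?thesis by (rule tendsto_unique[rotated]) simp
    qed
    then show "(x, y) \<in> adjoint_op A" by (auto simp: adjoint_op_def)
  next
    assume "(x, y) \<in> adjoint_op A"
    then have adj: "inner v x = inner u y" if "(u, v) \<in> generator S" for u v
      using that by (auto simp: adjoint_op_def A)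
    let ?\<psi> = "\<lambda>s. ?R (max 0 s) y"
    have cR: "continuous_on UNIV ?\<psi>"
      by (intro C0_semigroup_continuous_compose[OF R] continuous_intros)
    have intR: "?\<psi> integrable_on {0..t}" for t
      using cR continuous_on_subset by (intro integrable_continuous_real) blast
    have eq: "?R t x - x = integral {0..t} ?\<psi>" if t: "t \<ge> 0" for t
    proof (rule eq_if_inner_eq)
      fix u
      have intS: "(\<lambda>s. S (max 0 s) u) integrable_on {0..t}"
        by (intro integrable_continuous_real C0_semigroup_continuous_compose[OF S] continuous_intros)
      have "inner u (?R t x - x) = inner (S t u - u) x"
        using t by (simp add: R_inner inner_diff_right inner_diff_left)
      also have "\<dots> = inner (integral {0..t} (\<lambda>s. S (max 0 s) u)) y"
        by (rule adj, rule integral_orbit_in_generator[OF S t])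
      also have "\<dots> = integral {0..t} (\<lambda>s. inner u (?\<psi> s))"
        by (simp add: inner_integral_left[OF intS] R_inner)
      also have "\<dots> = inner u (integral {0..t} ?\<psi>)"
        by (simp add: inner_integral_right[OF intR])
      finally show "inner u (?R t x - x) = inner u (integral {0..t} ?\<psi>)" .
    qed
    have "((\<lambda>t. (1 / t) *\<^sub>R integral {0..0 + t} ?\<psi>) \<longlongrightarrow> ?\<psi> 0) (at_right 0)"
      by (rule average_tendsto[OF cR])
    then have "((\<lambda>t. (1 / t) *\<^sub>R (?R t x - x)) \<longlongrightarrow> ?\<psi> 0) (at_right 0)"
      by (rule Lim_transform_eventually, intro eventually_mono[OF ev]) (simp add: eq)
    then show "(x, y) \<in> generator ?R"
      by (simp add: generator_def C0_semigroupD(2)[OF R])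
  qed
  then have "generator ?R = adjoint_op A" by (auto simp: set_eq_iff)
  with R show ?thesis by (simp add: generates_def)
qed

section \<open>Strong measurability and square integrable functions\<close>

abbreviation Leb :: "real \<Rightarrow> real measure" where
  "Leb T \<equiv> lebesgue_on {0<..<T}"

lemma borel_measurable_Leb: "f \<in> borel_measurable borel \<Longrightarrow> f \<in> borel_measurable (Leb T)"
  by (intro measurable_restrict_space1 measurable_completion) simp

lemma finite_measure_Leb: "finite_measure (Leb T)"
  by (intro finite_measure_lebesgue_on) simp

text \<open>
  Altering \<open>f\<close> on a null set makes the approximating simple functions converge everywhere. Joint
  measurability on a product, needed for Fubini's theorem, is then a matter of pointwise limits.
\<close>

lemma strongly_measurable_representative:
  fixes f :: "'a \<Rightarrow> 'b::real_normed_vector"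
  assumes "strongly_measurable M f"
  obtains f' s where "\<And>n::nat. simple_function M (s n)"
    and "\<And>x. x \<in> space M \<Longrightarrow> (\<lambda>n. s n x) \<longlonglongrightarrow> f' x" and "AE x in M. f x = f' x"
proof -
  obtain s where s: "\<And>n::nat. simple_function M (s n)" "AE x in M. (\<lambda>n. s n x) \<longlonglongrightarrow> f x"
    using assms unfolding strongly_measurable_def by blast
  from s(2) obtain N where N: "\<And>x. x \<in> space M - N \<Longrightarrow> (\<lambda>n. s n x) \<longlonglongrightarrow> f x" "N \<in> null_sets M"
    by (rule AE_E3) blast
  show thesis
  proof (rule that)
    show "simple_function M (\<lambda>x. if x \<in> N then 0 else s n x)" for n
      using N(2) by (intro simple_function_If_set s simple_function_const) auto
    show "(\<lambda>n. if x \<in> N then 0 else s n x) \<longlonglongrightarrow> (if x \<in> N then 0 else f x)" if "x \<in> space M" for x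
      using N(1)[of x] that by auto
    show "AE x in M. f x = (if x \<in> N then 0 else f x)"
      using AE_not_in[OF N(2)] by eventually_elim simp
  qed
qed

lemma strongly_measurable_simple_function:
  "simple_function M f \<Longrightarrow> strongly_measurable M f"
  unfolding strongly_measurable_def by (intro exI[of _ "\<lambda>_. f"]) auto

lemma strongly_measurable_Pair:
  assumes "strongly_measurable M f" "strongly_measurable M g"
  shows "strongly_measurable M (\<lambda>x. (f x, g x))"
proof -
  obtain s t where s: "\<And>n::nat. simple_function M (s n)" "AE x in M. (\<lambda>n. s n x) \<longlonglongrightarrow> f x"
    and t: "\<And>n::nat. simple_function M (t n)" "AE x in M. (\<lambda>n. t n x) \<longlonglongrightarrow> g x"
    using assms unfolding strongly_measurable_def by blast
  have "AE x in M. (\<lambda>n. (s n x, t n x)) \<longlonglongrightarrow> (f x, g x)"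
    using s(2) t(2) by eventually_elim (rule tendsto_Pair)
  with s t show ?thesis
    unfolding strongly_measurable_def by (intro exI[of _ "\<lambda>n x. (s n x, t n x)"]) auto
qed

text \<open>
  The time \<open>s\<close> rounded down to a multiple of \<open>1 / (n + 1)\<close>: a simple approximation of the identity.
\<close>

definition grid :: "nat \<Rightarrow> real \<Rightarrow> real" where
  "grid n s = real_of_int \<lfloor>real (Suc n) * s\<rfloor> / real (Suc n)"

lemma simple_function_grid: "simple_function (Leb T) (grid n)"
proof (rule simple_function_borel_measurable)
  show "grid n \<in> borel_measurable (Leb T)"
    unfolding grid_def by (intro borel_measurable_Leb) measurable
  have "grid n ` space (Leb T) \<subseteq> (\<lambda>k. real_of_int k / real (Suc n)) ` {0..\<lfloor>real (Suc n) * T\<rfloor>}"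
    unfolding grid_def by (auto intro!: imageI floor_mono mult_left_mono)
  then show "finite (grid n ` space (Leb T))" by (rule finite_subset) simp
qed

lemma grid_tendsto: "(\<lambda>n. grid n s) \<longlonglongrightarrow> s"
proof (rule tendsto_sandwich)
  have le: "\<And>n. grid n s \<le> s"
    unfolding grid_def by (simp add: divide_le_eq mult.commute del: of_nat_Suc)
  have ge: "s - inverse (real (Suc n)) \<le> grid n s" for n
  proof -
    have "real (Suc n) * s - 1 \<le> real_of_int \<lfloor>real (Suc n) * s\<rfloor>" by linarith
    then have "(real (Suc n) * s - 1) / real (Suc n) \<le> grid n s"
      unfolding grid_def by (rule divide_right_mono) simp
    then show ?thesis by (simp add: diff_divide_distrib inverse_eq_divide del: of_nat_Suc)
  qed
  show "eventually (\<lambda>n. s - inverse (real (Suc n)) \<le> grid n s) sequentially"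
    "eventually (\<lambda>n. grid n s \<le> s) sequentially" using le ge by auto
  show "(\<lambda>n. s - inverse (real (Suc n))) \<longlonglongrightarrow> s"
    using tendsto_diff[OF tendsto_const LIMSEQ_inverse_real_of_nat, of s] by simp
qed simp

text \<open>
  Substituting \<open>grid n s\<close> and the \<open>n\<close>-th simple approximation of \<open>f\<close> into \<open>\<phi>\<close> gives simple functions that
  converge by joint continuity.
\<close>

lemma strongly_measurable_compose:
  fixes \<phi> :: "real \<Rightarrow> 'a::real_normed_vector \<Rightarrow> 'b::topological_space"
  assumes f: "strongly_measurable (Leb T) f"
    and \<phi>: "continuous_on UNIV (\<lambda>p. \<phi> (fst p) (snd p))"
  shows "strongly_measurable (Leb T) (\<lambda>s. \<phi> s (f s))"
proof -
  obtain s where s: "\<And>n::nat. simple_function (Leb T) (s n)" "AE x in Leb T. (\<lambda>n. s n x) \<longlonglongrightarrow> f x"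
    using f unfolding strongly_measurable_def by blast
  have "simple_function (Leb T) (\<lambda>x. \<phi> (grid n x) (s n x))" for n
    by (intro simple_function_compose2[where h = \<phi>] simple_function_grid s)
  moreover have "AE x in Leb T. (\<lambda>n. \<phi> (grid n x) (s n x)) \<longlonglongrightarrow> \<phi> x (f x)"
    using s(2)
  proof eventually_elim
    case (elim x)
    have "isCont (\<lambda>p. \<phi> (fst p) (snd p)) (x, f x)"
      using \<phi> by (simp add: continuous_on_eq_continuous_at)
    from isCont_tendsto_compose[OF this tendsto_Pair[OF grid_tendsto elim]]
    show ?case by simp
  qed
  ultimately show ?thesis unfolding strongly_measurable_def
    by (intro exI[of _ "\<lambda>n x. \<phi> (grid n x) (s n x)"] conjI allI)
qed

lemma strongly_measurable_continuous_image:
  fixes f :: "real \<Rightarrow> 'a::real_normed_vector"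
  assumes f: "strongly_measurable (Leb T) f" and g: "continuous_on UNIV g"
  shows "strongly_measurable (Leb T) (\<lambda>s. g (f s))"
proof -
  have "continuous_on UNIV (\<lambda>p::real \<times> 'a. g (snd p))"
    by (intro continuous_on_compose2[OF g] continuous_intros) simp
  then show ?thesis by (rule strongly_measurable_compose[OF f, where \<phi> = "\<lambda>_. g"])
qed

lemma strongly_measurable_continuous:
  fixes f :: "real \<Rightarrow> 'a::real_normed_vector"
  assumes f: "continuous_on UNIV f"
  shows "strongly_measurable (Leb T) f"
proof -
  have "continuous_on UNIV (\<lambda>p::real \<times> real. f (fst p))"
    by (intro continuous_on_compose2[OF f] continuous_intros) simp
  then show ?thesis
    by (rule strongly_measurable_compose[OF strongly_measurable_simple_function[OF simple_function_const],
          where \<phi> = "\<lambda>s _. f s"])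
qed

lemma strongly_measurable_add:
  fixes f g :: "real \<Rightarrow> 'a::real_normed_vector"
  assumes "strongly_measurable (Leb T) f" "strongly_measurable (Leb T) g"
  shows "strongly_measurable (Leb T) (\<lambda>s. f s + g s)"
  using strongly_measurable_continuous_image[OF strongly_measurable_Pair[OF assms], of "\<lambda>p. fst p + snd p"]
  by (simp add: continuous_intros)

lemma strongly_measurable_diff:
  fixes f g :: "real \<Rightarrow> 'a::real_normed_vector"
  assumes "strongly_measurable (Leb T) f" "strongly_measurable (Leb T) g"
  shows "strongly_measurable (Leb T) (\<lambda>s. f s - g s)"
  using strongly_measurable_continuous_image[OF strongly_measurable_Pair[OF assms], of "\<lambda>p. fst p - snd p"]
  by (simp add: continuous_intros)

lemma strongly_measurable_if:
  fixes f :: "real \<Rightarrow> 'a::real_normed_vector"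
  assumes "strongly_measurable (Leb T) f" and A: "A \<in> sets lebesgue"
  shows "strongly_measurable (Leb T) (\<lambda>s. if s \<in> A then f s else 0)"
proof -
  obtain s where s: "\<And>n::nat. simple_function (Leb T) (s n)" "AE x in Leb T. (\<lambda>n. s n x) \<longlonglongrightarrow> f x"
    using assms unfolding strongly_measurable_def by blast
  have "A \<inter> space (Leb T) \<in> sets (Leb T)"
    using A by (auto simp: sets_restrict_space)
  then have "simple_function (Leb T) (\<lambda>x. if x \<in> A then s n x else 0)" for n
    by (intro simple_function_If_set s simple_function_const)
  moreover have "AE x in Leb T. (\<lambda>n. if x \<in> A then s n x else 0) \<longlonglongrightarrow> (if x \<in> A then f x else 0)"
    using s(2) by eventually_elim auto
  ultimately show ?thesis
    unfolding strongly_measurable_def by (intro exI[of _ "\<lambda>n x. if x \<in> A then s n x else 0"]) auto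
qed

lemma borel_measurable_strongly_measurable:
  fixes f :: "real \<Rightarrow> real"
  assumes "strongly_measurable (Leb T) f"
  shows "f \<in> borel_measurable (Leb T)"
proof -
  from assms obtain f' s where s: "\<And>n::nat. simple_function (Leb T) (s n)"
    "\<And>x. x \<in> space (Leb T) \<Longrightarrow> (\<lambda>n. s n x) \<longlonglongrightarrow> f' x" and eq: "AE x in Leb T. f x = f' x"
    by (rule strongly_measurable_representative) blast
  have "f' \<in> borel_measurable (Leb T)"
    by (rule borel_measurable_LIMSEQ_real[OF s(2)])
       (auto intro: borel_measurable_simple_function s(1))
  then have "(\<lambda>x. if x \<in> {0<..<T} then f' x else 0) \<in> borel_measurable lebesgue"
    by (subst borel_measurable_if) auto
  moreover have "AE x in lebesgue. (if x \<in> {0<..<T} then f' x else 0) = (if x \<in> {0<..<T} then f x else 0)"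
  proof -
    have "AE x in lebesgue. x \<in> {0<..<T} \<longrightarrow> f x = f' x"
      using eq by (subst (asm) AE_restrict_space_iff) auto
    then show ?thesis by eventually_elim auto
  qed
  ultimately have "(\<lambda>x. if x \<in> {0<..<T} then f x else 0) \<in> borel_measurable lebesgue"
    by (rule borel_measurable_AE)
  then show ?thesis by (subst (asm) borel_measurable_if) auto
qed

lemma borel_measurable_norm_strongly:
  fixes f :: "real \<Rightarrow> 'a::real_normed_vector"
  assumes "strongly_measurable (Leb T) f"
  shows "(\<lambda>s. norm (f s)) \<in> borel_measurable (Leb T)"
  by (intro borel_measurable_strongly_measurable strongly_measurable_continuous_image[OF assms] continuous_intros)

lemma borel_measurable_inner_strongly:
  fixes f g :: "real \<Rightarrow> 'a::real_inner"
  assumes "strongly_measurable (Leb T) f" "strongly_measurable (Leb T) g"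
  shows "(\<lambda>s. inner (f s) (g s)) \<in> borel_measurable (Leb T)"
proof -
  have "continuous_on UNIV (\<lambda>p::'a \<times> 'a. inner (fst p) (snd p))" by (intro continuous_intros)
  from borel_measurable_strongly_measurable[OF strongly_measurable_continuous_image[OF
      strongly_measurable_Pair[OF assms] this]]
  show ?thesis by simp
qed

text \<open>
  The Riemann sums of \<open>f\<close> and \<open>F n\<close> over a fine tagged division differ by at most the Riemann sum of
  \<open>norm (f - F n)\<close>, which is close to its small integral; so \<open>f\<close> inherits the Cauchy criterion.
\<close>

lemma integrable_on_L1_limit:
  fixes f :: "real \<Rightarrow> 'a::banach"
  assumes F: "\<And>n. F n integrable_on {a..b}"
    and N: "\<And>n. (\<lambda>x. norm (f x - F n x)) integrable_on {a..b}"
    and lim: "(\<lambda>n. integral {a..b} (\<lambda>x. norm (f x - F n x))) \<longlonglongrightarrow> 0"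
  shows "f integrable_on {a..b}"
proof -
  have "f integrable_on cbox a b"
    unfolding integrable_Cauchy
  proof (intro allI impI)
    fix e :: real assume e: "e > 0"
    then have e6: "e / 6 > 0" by simp
    obtain n where n: "integral {a..b} (\<lambda>x. norm (f x - F n x)) < e / 6"
      using order_tendstoD(2)[OF lim e6] eventually_sequentially by auto
    let ?g = "\<lambda>x. norm (f x - F n x)"
    have IF: "(F n has_integral integral (cbox a b) (F n)) (cbox a b)"
      and IG: "(?g has_integral integral (cbox a b) ?g) (cbox a b)"
      using F[of n] N[of n] by (simp_all add: integrable_integral)
    obtain \<gamma>1 where \<gamma>1: "gauge \<gamma>1 \<and> (\<forall>\<D>. \<D> tagged_division_of cbox a b \<and> \<gamma>1 fine \<D> \<longrightarrow>
        norm ((\<Sum>(x,k)\<in>\<D>. measure lborel k *\<^sub>R F n x) - integral (cbox a b) (F n)) < e / 6)"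
      using IF[unfolded has_integral, rule_format, OF e6] that by (rule exE)
    obtain \<gamma>2 where \<gamma>2: "gauge \<gamma>2 \<and> (\<forall>\<D>. \<D> tagged_division_of cbox a b \<and> \<gamma>2 fine \<D> \<longrightarrow>
        norm ((\<Sum>(x,k)\<in>\<D>. measure lborel k *\<^sub>R ?g x) - integral (cbox a b) ?g) < e / 6)"
      using IG[unfolded has_integral, rule_format, OF e6] that by (rule exE)
    have *: "norm ((\<Sum>(x,k)\<in>\<D>. measure lborel k *\<^sub>R f x) - integral (cbox a b) (F n)) < e / 2"
      if \<D>: "\<D> tagged_division_of cbox a b" "(\<lambda>x. \<gamma>1 x \<inter> \<gamma>2 x) fine \<D>" for \<D>
    proof -
      have fine: "\<gamma>1 fine \<D>" "\<gamma>2 fine \<D>" using \<D>(2) by (auto simp: fine_Int)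
      have "(\<Sum>(x,k)\<in>\<D>. measure lborel k *\<^sub>R f x) - (\<Sum>(x,k)\<in>\<D>. measure lborel k *\<^sub>R F n x)
          = (\<Sum>(x,k)\<in>\<D>. measure lborel k *\<^sub>R (f x - F n x))"
        by (simp add: sum_subtractf[symmetric] scaleR_diff_right split_def)
      then have "norm ((\<Sum>(x,k)\<in>\<D>. measure lborel k *\<^sub>R f x) - (\<Sum>(x,k)\<in>\<D>. measure lborel k *\<^sub>R F n x))
          \<le> (\<Sum>(x,k)\<in>\<D>. norm (measure lborel k *\<^sub>R (f x - F n x)))"
        by (simp only: split_def) (rule norm_sum)
      also have "\<dots> = (\<Sum>(x,k)\<in>\<D>. measure lborel k *\<^sub>R ?g x)" by (simp add: split_def)
      also have "\<dots> < e / 6 + e / 6"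
        using conjunct2[OF \<gamma>2, rule_format, OF conjI[OF \<D>(1) fine(2)]] n
        unfolding box_real real_norm_def by linarith
      finally have 1: "norm ((\<Sum>(x,k)\<in>\<D>. measure lborel k *\<^sub>R f x) - (\<Sum>(x,k)\<in>\<D>. measure lborel k *\<^sub>R F n x)) < e / 3"
        by simp
      have 2: "norm ((\<Sum>(x,k)\<in>\<D>. measure lborel k *\<^sub>R F n x) - integral (cbox a b) (F n)) < e / 6"
        using \<gamma>1 \<D>(1) fine(1) by simp
      show ?thesis using norm_triangle_lt[OF add_strict_mono[OF 1 2]] by simp
    qed
    show "\<exists>\<gamma>. gauge \<gamma> \<and>
          (\<forall>\<D>1 \<D>2. \<D>1 tagged_division_of (cbox a b) \<and> \<gamma> fine \<D>1 \<and>
            \<D>2 tagged_division_of (cbox a b) \<and> \<gamma> fine \<D>2 \<longrightarrow>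
            norm ((\<Sum>(x,K)\<in>\<D>1. measure lborel K *\<^sub>R f x) - (\<Sum>(x,K)\<in>\<D>2. measure lborel K *\<^sub>R f x)) < e)"
    proof (intro exI conjI allI impI)
      show "gauge (\<lambda>x. \<gamma>1 x \<inter> \<gamma>2 x)" using \<gamma>1 \<gamma>2 by (simp add: gauge_Int)
      fix \<D>1 \<D>2 assume "\<D>1 tagged_division_of cbox a b \<and> (\<lambda>x. \<gamma>1 x \<inter> \<gamma>2 x) fine \<D>1 \<and>
            \<D>2 tagged_division_of cbox a b \<and> (\<lambda>x. \<gamma>1 x \<inter> \<gamma>2 x) fine \<D>2"
      then have "norm ((\<Sum>(x,k)\<in>\<D>1. measure lborel k *\<^sub>R f x) - integral (cbox a b) (F n)) < e / 2"
        "norm ((\<Sum>(x,k)\<in>\<D>2. measure lborel k *\<^sub>R f x) - integral (cbox a b) (F n)) < e / 2"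
        using * by blast+
      then show "norm ((\<Sum>(x,K)\<in>\<D>1. measure lborel K *\<^sub>R f x) - (\<Sum>(x,K)\<in>\<D>2. measure lborel K *\<^sub>R f x)) < e"
        using norm_diff_triangle_less[of _ "integral (cbox a b) (F n)" "e / 2" _ "e / 2"]
        by (simp add: norm_minus_commute)
    qed
  qed
  then show ?thesis by simp
qed

lemma integrable_on_simple_function:
  fixes s :: "real \<Rightarrow> 'a::banach"
  assumes s: "simple_function (Leb T) s"
  shows "s integrable_on {0..T}"
proof -
  let ?V = "s ` {0<..<T}" and ?A = "\<lambda>v. s -` {v} \<inter> {0<..<T}"
  have fin: "finite ?V" using simple_functionD(1)[OF s] by simp
  have A: "?A v \<in> sets (Leb T)" for v using simple_functionD(2)[OF s, of "{v}"] by simp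
  interpret finite_measure "Leb T" by (rule finite_measure_Leb)
  have "(\<lambda>x. indicat_real (?A v) x *\<^sub>R v) integrable_on {0<..<T}" for v
  proof -
    have "integrable (Leb T) (indicat_real (?A v))"
      using A[of v] by (intro integrable_real_indicator) (auto simp: emeasure_finite less_top[symmetric])
    then have "indicat_real (?A v) integrable_on {0<..<T}"
      by (rule integrable_on_lebesgue_on) simp
    from integrable_linear[OF this bounded_linear_scaleR_left[of v]]
    show ?thesis by (simp add: o_def)
  qed
  then have "(\<lambda>x. \<Sum>v\<in>?V. indicat_real (?A v) x *\<^sub>R v) integrable_on {0<..<T}"
    using fin by (intro integrable_sum) auto
  moreover have "(\<Sum>v\<in>?V. indicat_real (?A v) x *\<^sub>R v) = s x" if "x \<in> {0<..<T}" for x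
  proof -
    have "(\<Sum>v\<in>?V. indicat_real (?A v) x *\<^sub>R v) = (\<Sum>v\<in>?V. if v = s x then v else 0)"
      using that by (intro sum.cong) (auto simp: indicator_def)
    then show ?thesis using fin that by simp
  qed
  ultimately have "s integrable_on {0<..<T}"
    by (rule integrable_eq)
  then show ?thesis by (simp add: integrable_on_Icc_iff_Ioo)
qed

lemma LINT_Leb_eq_integral:
  fixes f :: "real \<Rightarrow> real"
  assumes "integrable (Leb T) f"
  shows "f integrable_on {0..T}" "(LINT s|Leb T. f s) = integral {0..T} f"
  using integrable_on_lebesgue_on[OF assms] lebesgue_integral_eq_integral[OF assms]
  by (simp_all add: integrable_on_Icc_iff_Ioo integral_open_interval_real)

text \<open>
  Truncating the simple approximations where they exceed \<open>2 * norm (f x)\<close> yields dominated convergence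
  of the scalar functions \<open>norm (f - r n)\<close>, that is, convergence in \<open>L\<^sup>1\<close>. So Bochner integrability
  implies gauge integrability in every Banach space.
\<close>

lemma integrable_on_strongly_measurable:
  fixes f :: "real \<Rightarrow> 'a::banach"
  assumes f: "strongly_measurable (Leb T) f" and int: "integrable (Leb T) (\<lambda>s. norm (f s))"
  shows "f integrable_on {0..T}"
proof -
  obtain s where s: "\<And>n::nat. simple_function (Leb T) (s n)" "AE x in Leb T. (\<lambda>n. s n x) \<longlonglongrightarrow> f x"
    using f unfolding strongly_measurable_def by blast
  have [measurable]: "(\<lambda>s. norm (f s)) \<in> borel_measurable (Leb T)"
    by (rule borel_measurable_norm_strongly[OF f])
  define r where "r n x = (if norm (s n x) \<le> 2 * norm (f x) then s n x else 0)" for n x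
  have r: "simple_function (Leb T) (r n)" for n
  proof -
    have [measurable]: "(\<lambda>x. norm (s n x)) \<in> borel_measurable (Leb T)"
      by (intro borel_measurable_norm_strongly strongly_measurable_simple_function s)
    have "{x \<in> space (Leb T). norm (s n x) \<le> 2 * norm (f x)} \<in> sets (Leb T)" by measurable
    then show ?thesis unfolding r_def by (intro simple_function_If s simple_function_const)
  qed
  have meas: "(\<lambda>x. norm (f x - r n x)) \<in> borel_measurable (Leb T)" for n
    by (intro borel_measurable_norm_strongly strongly_measurable_diff f strongly_measurable_simple_function r)
  have bound: "AE x in Leb T. norm (norm (f x - r n x)) \<le> 3 * norm (f x)" for n
    by (rule AE_I2) (auto simp: r_def intro!: order_trans[OF norm_triangle_ineq4])
  have int3: "integrable (Leb T) (\<lambda>x. 3 * norm (f x))" using int by simp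
  have lim: "AE x in Leb T. (\<lambda>n. norm (f x - r n x)) \<longlonglongrightarrow> 0"
    using s(2)
  proof eventually_elim
    case (elim x)
    have "(\<lambda>n. r n x) \<longlonglongrightarrow> f x"
    proof (cases "f x = 0")
      case True
      then have "r n x = 0" for n by (simp add: r_def)
      then show ?thesis using True by simp
    next
      case False
      then have "norm (f x) < 2 * norm (f x)" by simp
      then have "eventually (\<lambda>n. norm (s n x) < 2 * norm (f x)) sequentially"
        using order_tendstoD(2)[OF tendsto_norm[OF elim]] by blast
      then have "eventually (\<lambda>n. s n x = r n x) sequentially"
        by eventually_elim (simp add: r_def)
      with elim show ?thesis by (rule Lim_transform_eventually)
    qed
    then have "(\<lambda>n. norm (f x - r n x)) \<longlonglongrightarrow> norm (f x - f x)" by (intro tendsto_intros)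
    then show ?case by simp
  qed
  have intn: "integrable (Leb T) (\<lambda>x. norm (f x - r n x))" for n
    by (rule integrable_dominated_convergence2[OF _ meas int3 lim bound]) simp
  have "(\<lambda>n. LINT x|Leb T. norm (f x - r n x)) \<longlonglongrightarrow> (LINT x|Leb T. 0)"
    by (rule integral_dominated_convergence[OF _ meas int3 lim bound]) simp
  then show ?thesis
    using integrable_on_L1_limit[of r 0 T f] integrable_on_simple_function[OF r] LINT_Leb_eq_integral[OF intn]
    by simp
qed

lemma norm_integral_le_LINT:
  fixes f :: "real \<Rightarrow> 'a::banach"
  assumes f: "strongly_measurable (Leb T) f" and int: "integrable (Leb T) (\<lambda>s. norm (f s))"
  shows "norm (integral {0..T} f) \<le> (LINT s|Leb T. norm (f s))"
  using Henstock_Kurzweil_Integration.integral_norm_bound_integral[OF integrable_on_strongly_measurable[OF f int]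
      LINT_Leb_eq_integral(1)[OF int]] LINT_Leb_eq_integral(2)[OF int]
  by simp

lemma integrable_norm_bound:
  fixes f :: "real \<Rightarrow> 'a::real_normed_vector"
  assumes "strongly_measurable (Leb T) f" "integrable (Leb T) g"
    and "\<And>s. s \<in> {0<..<T} \<Longrightarrow> norm (f s) \<le> g s"
  shows "integrable (Leb T) (\<lambda>s. norm (f s))"
  by (rule Bochner_Integration.integrable_bound[OF assms(2) borel_measurable_norm_strongly[OF assms(1)]])
     (rule AE_I2, use assms(3) in force)

lemma L2D:
  assumes "f \<in> L2 T"
  shows "strongly_measurable (Leb T) f" "integrable (Leb T) (\<lambda>t. (norm (f t))\<^sup>2)"
  using assms by (auto simp: L2_def)

lemma L2I_bound:
  fixes f :: "real \<Rightarrow> 'a::real_normed_vector"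
  assumes f: "strongly_measurable (Leb T) f" and g: "integrable (Leb T) g"
    and le: "\<And>s. s \<in> {0<..<T} \<Longrightarrow> (norm (f s))\<^sup>2 \<le> g s"
  shows "f \<in> L2 T"
proof -
  note [measurable] = borel_measurable_norm_strongly[OF f]
  have "integrable (Leb T) (\<lambda>t. (norm (f t))\<^sup>2)"
    by (rule Bochner_Integration.integrable_bound[OF g], measurable, rule AE_I2) (use le in force)
  with f show ?thesis by (simp add: L2_def)
qed

lemma L2_integrable_norm:
  assumes "f \<in> L2 T"
  shows "integrable (Leb T) (\<lambda>s. norm (f s))"
proof (rule integrable_norm_bound)
  interpret finite_measure "Leb T" by (rule finite_measure_Leb)
  show "integrable (Leb T) (\<lambda>s. 1 + (norm (f s))\<^sup>2)"
    using L2D[OF assms] by (intro Bochner_Integration.integrable_add) auto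
  show "norm (f s) \<le> 1 + (norm (f s))\<^sup>2" for s
    using zero_le_power2[of "norm (f s) - 1/2"] by (simp add: power2_eq_square algebra_simps)
qed (rule L2D[OF assms])

lemma L2_integrable_inner:
  assumes "f \<in> L2 T" "g \<in> L2 T"
  shows "integrable (Leb T) (\<lambda>s. inner (f s) (g s))"
proof (rule Bochner_Integration.integrable_bound)
  show "integrable (Leb T) (\<lambda>s. (norm (f s))\<^sup>2 + (norm (g s))\<^sup>2)"
    using L2D assms by (intro Bochner_Integration.integrable_add) auto
  show "(\<lambda>s. inner (f s) (g s)) \<in> borel_measurable (Leb T)"
    using L2D assms by (intro borel_measurable_inner_strongly) auto
  have "\<bar>inner (f s) (g s)\<bar> \<le> (norm (f s))\<^sup>2 + (norm (g s))\<^sup>2" for s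
  proof -
    have "\<bar>inner (f s) (g s)\<bar> \<le> norm (f s) * norm (g s)" by (rule Cauchy_Schwarz_ineq2)
    moreover have "2 * (norm (f s) * norm (g s)) \<le> (norm (f s))\<^sup>2 + (norm (g s))\<^sup>2"
      using sum_squares_bound[of "norm (f s)" "norm (g s)"] by simp
    moreover have "0 \<le> norm (f s) * norm (g s)" by simp
    ultimately show ?thesis by linarith
  qed
  then show "AE s in Leb T. norm (inner (f s) (g s)) \<le> norm ((norm (f s))\<^sup>2 + (norm (g s))\<^sup>2)"
    by (intro AE_I2) simp
qed

lemma L2_bounded_linear_image:
  assumes f: "f \<in> L2 T" and F: "bounded_linear F"
  shows "(\<lambda>s. F (f s)) \<in> L2 T"
proof -
  obtain K where K: "K \<ge> 0" "\<And>x. norm (F x) \<le> norm x * K"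
    using bounded_linear.nonneg_bounded[OF F] by blast
  show ?thesis
  proof (rule L2I_bound)
    show "strongly_measurable (Leb T) (\<lambda>s. F (f s))"
      by (rule strongly_measurable_continuous_image[OF L2D(1)[OF f]
            bounded_linear.continuous_on[OF F continuous_on_id]])
    show "integrable (Leb T) (\<lambda>s. (norm (f s))\<^sup>2 * K\<^sup>2)" using L2D[OF f] by simp
    show "(norm (F (f s)))\<^sup>2 \<le> (norm (f s))\<^sup>2 * K\<^sup>2" for s
      using power_mono[OF K(2)[of "f s"] norm_ge_zero, of 2] by (simp add: power_mult_distrib)
  qed
qed

lemma L2_add:
  assumes f: "f \<in> L2 T" and g: "g \<in> L2 T"
  shows "(\<lambda>s. f s + g s) \<in> L2 T"
proof (rule L2I_bound)
  show "strongly_measurable (Leb T) (\<lambda>s. f s + g s)"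
    by (intro strongly_measurable_add L2D[OF f] L2D[OF g])
  show "integrable (Leb T) (\<lambda>s. 2 * (norm (f s))\<^sup>2 + 2 * (norm (g s))\<^sup>2)"
    using L2D[OF f] L2D[OF g] by simp
  show "(norm (f s + g s))\<^sup>2 \<le> 2 * (norm (f s))\<^sup>2 + 2 * (norm (g s))\<^sup>2" for s
  proof -
    have "(norm (f s + g s))\<^sup>2 \<le> (norm (f s) + norm (g s))\<^sup>2"
      by (intro power_mono norm_triangle_ineq) simp
    also have "\<dots> \<le> 2 * (norm (f s))\<^sup>2 + 2 * (norm (g s))\<^sup>2"
      using sum_squares_bound[of "norm (f s)" "norm (g s)"] by (simp add: power2_sum)
    finally show ?thesis .
  qed
qed

lemma L2_scaleR: "f \<in> L2 T \<Longrightarrow> (\<lambda>s. c *\<^sub>R f s) \<in> L2 T"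
  by (rule L2_bounded_linear_image[OF _ bounded_linear_scaleR_right])

lemma L2_uminus: "f \<in> L2 T \<Longrightarrow> (\<lambda>s. - f s) \<in> L2 T"
  by (rule L2_bounded_linear_image[OF _ bounded_linear_minus[OF bounded_linear_ident]])

lemma L2_diff: "f \<in> L2 T \<Longrightarrow> g \<in> L2 T \<Longrightarrow> (\<lambda>s. f s - g s) \<in> L2 T"
  using L2_add[OF _ L2_uminus[of g]] by simp

lemma L2_zero: "(\<lambda>s. 0) \<in> L2 T"
  by (rule L2I_bound[of _ _ "\<lambda>_. 0"]) (auto intro: strongly_measurable_simple_function)

lemma L2_sum: "(\<And>i. i \<in> I \<Longrightarrow> f i \<in> L2 T) \<Longrightarrow> (\<lambda>s. \<Sum>i\<in>I. f i s) \<in> L2 T"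
  by (induction I rule: infinite_finite_induct) (auto simp: L2_zero L2_add)

lemma L2_continuous:
  assumes f: "continuous_on UNIV f"
  shows "f \<in> L2 T"
proof -
  have "continuous_on {0..T} (\<lambda>s. (norm (f s))\<^sup>2)"
    by (intro continuous_intros continuous_on_subset[OF f]) simp
  from compact_imp_bounded[OF compact_continuous_image[OF this compact_Icc]]
  obtain K where K: "\<forall>s\<in>{0..T}. norm ((norm (f s))\<^sup>2) \<le> K"
    unfolding bounded_iff by auto
  interpret finite_measure "Leb T" by (rule finite_measure_Leb)
  show ?thesis
    by (rule L2I_bound[OF strongly_measurable_continuous[OF f], where g = "\<lambda>_. K"]) (use K in auto)
qed

lemma L2_inner_add_left:
  "f \<in> L2 T \<Longrightarrow> g \<in> L2 T \<Longrightarrow> h \<in> L2 T \<Longrightarrow> L2_inner T (\<lambda>s. f s + g s) h = L2_inner T f h + L2_inner T g h"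
  unfolding L2_inner_def by (simp add: inner_add_left L2_integrable_inner)

lemma L2_inner_commute: "L2_inner T f g = L2_inner T g f"
  unfolding L2_inner_def by (simp add: inner_commute)

lemma L2_inner_scaleR_left: "L2_inner T (\<lambda>s. c *\<^sub>R f s) g = c * L2_inner T f g"
  unfolding L2_inner_def by simp

lemma L2_inner_diff_left:
  "f \<in> L2 T \<Longrightarrow> g \<in> L2 T \<Longrightarrow> h \<in> L2 T \<Longrightarrow> L2_inner T (\<lambda>s. f s - g s) h = L2_inner T f h - L2_inner T g h"
  unfolding L2_inner_def by (simp add: inner_diff_left L2_integrable_inner)

lemma L2_inner_diff_right:
  "f \<in> L2 T \<Longrightarrow> g \<in> L2 T \<Longrightarrow> h \<in> L2 T \<Longrightarrow> L2_inner T h (\<lambda>s. f s - g s) = L2_inner T h f - L2_inner T h g"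
  unfolding L2_inner_def by (simp add: inner_diff_right L2_integrable_inner)

lemma L2_inner_sum_right:
  assumes "f \<in> L2 T" "\<And>i. i \<in> I \<Longrightarrow> e i \<in> L2 T"
  shows "L2_inner T f (\<lambda>s. \<Sum>i\<in>I. c i *\<^sub>R e i s) = (\<Sum>i\<in>I. c i * L2_inner T f (e i))"
  unfolding L2_inner_def using assms
  by (simp add: inner_sum_right Bochner_Integration.integral_sum L2_integrable_inner)

lemma L2_inner_cong_right:
  assumes "f \<in> L2 T" "g \<in> L2 T" "h \<in> L2 T" "L2_eq T g h"
  shows "L2_inner T f g = L2_inner T f h"
  unfolding L2_inner_def
proof (rule integral_cong_AE)
  show "AE s in Leb T. inner (f s) (g s) = inner (f s) (h s)"
    using assms(4) unfolding L2_eq_def by eventually_elim simp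
qed (use assms L2_integrable_inner borel_measurable_integrable in blast)+

lemma L2_eq_zero_if_inner_zero:
  assumes f: "f \<in> L2 T" and 0: "L2_inner T f f = 0"
  shows "L2_eq T f (\<lambda>s. 0)"
proof -
  have "AE s in Leb T. inner (f s) (f s) = 0"
    using 0 unfolding L2_inner_def
    by (subst (asm) integral_nonneg_eq_0_iff_AE) (auto simp: L2_integrable_inner f)
  then show ?thesis unfolding L2_eq_def by eventually_elim simp
qed

lemma L2_norm_square: "(L2_norm T f)\<^sup>2 = L2_inner T f f"
  unfolding L2_norm_def L2_inner_def by (simp add: power2_norm_eq_inner)

text \<open>
  Time reversal preserves Lebesgue measure on \<open>(0, T)\<close>; backward equations are reduced to forward ones
  by it.
\<close>

lemma distr_reflect_Leb: "distr (Leb T) (Leb T) (\<lambda>s. T - s) = Leb T"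
  and measurable_reflect_Leb: "(\<lambda>s. T - s) \<in> Leb T \<rightarrow>\<^sub>M Leb T"
proof -
  let ?h = "\<lambda>s::real. T - s"
  have h: "?h \<in> lebesgue \<rightarrow>\<^sub>M lebesgue"
    using lebesgue_affine_measurable[of "\<lambda>_. -1::real" T] by simp
  have lebesgue: "distr lebesgue lebesgue ?h = lebesgue"
    using lebesgue_real_affine[of "-1" T] by (simp add: density_1)
  show m: "?h \<in> Leb T \<rightarrow>\<^sub>M Leb T"
    by (rule measurable_restrict_space3[OF h]) auto
  show "distr (Leb T) (Leb T) ?h = Leb T"
  proof (rule measure_eqI)
    fix A assume "A \<in> sets (distr (Leb T) (Leb T) ?h)"
    then have A: "A \<in> sets (Leb T)" by simp
    then have A': "A \<subseteq> {0<..<T}" "A \<in> sets lebesgue"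
      by (auto simp: sets_restrict_space_iff)
    have "emeasure (distr (Leb T) (Leb T) ?h) A = emeasure (Leb T) (?h -` A \<inter> {0<..<T})"
      using emeasure_distr[OF m A] by simp
    also have "?h -` A \<inter> {0<..<T} = ?h -` A" using A'(1) by force
    also have "emeasure (Leb T) (?h -` A) = emeasure lebesgue (?h -` A)"
      using A'(1) by (intro emeasure_restrict_space) force+
    also have "\<dots> = emeasure (distr lebesgue lebesgue ?h) A"
      using emeasure_distr[OF h A'(2)] by simp
    also have "\<dots> = emeasure (Leb T) A"
      unfolding lebesgue using A'(1) by (intro emeasure_restrict_space[symmetric]) auto
    finally show "emeasure (distr (Leb T) (Leb T) ?h) A = emeasure (Leb T) A" .
  qed simp
qed

lemma AE_reflect_Leb:
  assumes "AE s in Leb T. P s"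
  shows "AE s in Leb T. P (T - s)"
proof -
  have "AE s in distr (Leb T) (Leb T) (\<lambda>s. T - s). P s"
    using assms unfolding distr_reflect_Leb .
  then show ?thesis by (rule AE_distrD[OF measurable_reflect_Leb])
qed

lemma L2_reflect:
  assumes f: "f \<in> L2 T"
  shows "(\<lambda>s. f (T - s)) \<in> L2 T"
proof -
  obtain s where s: "\<And>n::nat. simple_function (Leb T) (s n)" "AE x in Leb T. (\<lambda>n. s n x) \<longlonglongrightarrow> f x"
    using L2D(1)[OF f] unfolding strongly_measurable_def by blast
  have "strongly_measurable (Leb T) (\<lambda>s. f (T - s))"
    unfolding strongly_measurable_def
    by (intro exI[of _ "\<lambda>n x. s n (T - x)"] conjI allI
        simple_function_comp[OF measurable_reflect_Leb s(1)] AE_reflect_Leb[OF s(2)])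
  moreover have "integrable (Leb T) (\<lambda>s. (norm (f (T - s)))\<^sup>2)"
    using integrable_distr[OF measurable_reflect_Leb, of T "\<lambda>s. (norm (f s))\<^sup>2"] L2D(2)[OF f]
    by (simp add: distr_reflect_Leb)
  ultimately show ?thesis by (simp add: L2_def)
qed

section \<open>The variation of constants integral\<close>

definition duhamel :: "(real \<Rightarrow> 'h \<Rightarrow> 'h) \<Rightarrow> (real \<Rightarrow> 'h) \<Rightarrow> real \<Rightarrow> 'h::real_normed_vector" where
  "duhamel S f t = integral {0..t} (\<lambda>s. S (t - s) (f s))"

text \<open>
  The integrand extended by \<open>0\<close> to \<open>(0, T)\<close>: all integrals then run over a fixed interval, as
  dominated convergence and Fubini's theorem require.
\<close>

definition duhamel_kernel :: "(real \<Rightarrow> 'h \<Rightarrow> 'h) \<Rightarrow> (real \<Rightarrow> 'h) \<Rightarrow> real \<Rightarrow> real \<Rightarrow> 'h::real_normed_vector" where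
  "duhamel_kernel S f t s = (if s \<in> {0..t} then S (max 0 (t - s)) (f s) else 0)"

lemma duhamel_eq_integral_kernel:
  fixes S :: "real \<Rightarrow> 'h \<Rightarrow> 'h::banach"
  assumes "t \<in> {0..T}"
  shows "duhamel S f t = integral {0..T} (duhamel_kernel S f t)"
proof -
  have "integral {0..T} (duhamel_kernel S f t) = integral ({0..t} \<inter> {0..T}) (\<lambda>s. S (max 0 (t - s)) (f s))"
    unfolding duhamel_kernel_def by (rule integral_restrict_Int)
  also have "{0..t} \<inter> {0..T} = {0..t}" using assms by auto
  also have "integral {0..t} (\<lambda>s. S (max 0 (t - s)) (f s)) = duhamel S f t"
    unfolding duhamel_def by (rule integral_cong) (simp add: max_def)
  finally show ?thesis ..
qed

lemma strongly_measurable_duhamel_kernel: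
  fixes S :: "real \<Rightarrow> 'h \<Rightarrow> 'h::banach"
  assumes S: "C0_semigroup S" and f: "f \<in> L2 T"
  shows "strongly_measurable (Leb T) (duhamel_kernel S f t)"
proof -
  have "continuous_on UNIV (\<lambda>p::real \<times> 'h. S (max 0 (t - fst p)) (snd p))"
    by (intro C0_semigroup_continuous_compose[OF S] continuous_intros)
  then have "strongly_measurable (Leb T) (\<lambda>s. S (max 0 (t - s)) (f s))"
    by (rule strongly_measurable_compose[OF L2D(1)[OF f], where \<phi> = "\<lambda>s x. S (max 0 (t - s)) x"])
  then show ?thesis unfolding duhamel_kernel_def by (rule strongly_measurable_if) simp
qed

lemma norm_duhamel_kernel_le:
  fixes S :: "real \<Rightarrow> 'h \<Rightarrow> 'h::banach"
  assumes M: "\<forall>t\<in>{0..T}. \<forall>x. norm (S t x) \<le> M * norm x" "M \<ge> 0" and t: "t \<in> {0..T}"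
  shows "norm (duhamel_kernel S f t s) \<le> M * norm (f s)"
  using M t by (auto simp: duhamel_kernel_def)

lemma integrable_norm_duhamel_kernel:
  fixes S :: "real \<Rightarrow> 'h \<Rightarrow> 'h::banach"
  assumes S: "C0_semigroup S" and f: "f \<in> L2 T" and t: "t \<in> {0..T}"
  shows "integrable (Leb T) (\<lambda>s. norm (duhamel_kernel S f t s))"
proof -
  obtain M where M: "M \<ge> 0" "\<forall>t\<in>{0..T}. \<forall>x. norm (S t x) \<le> M * norm x"
    using C0_semigroup_bounded[OF S, of T] by (elim exE conjE)
  show ?thesis
    by (rule integrable_norm_bound[OF strongly_measurable_duhamel_kernel[OF S f], where g = "\<lambda>s. M * norm (f s)"])
       (use L2_integrable_norm[OF f] norm_duhamel_kernel_le[OF M(2,1) t] in auto)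
qed

text \<open>
  Dominated convergence of the kernels: they converge pointwise except at \<open>s = t\<close>, where the cut-off
  jumps.
\<close>

lemma continuous_on_duhamel:
  fixes S :: "real \<Rightarrow> 'h \<Rightarrow> 'h::banach"
  assumes S: "C0_semigroup S" and f: "f \<in> L2 T"
  shows "continuous_on {0..T} (duhamel S f)"
  unfolding continuous_on_sequentially
proof (intro allI ballI impI, elim conjE)
  fix \<tau> :: "nat \<Rightarrow> real" and t assume t: "t \<in> {0..T}" and \<tau>: "\<forall>n. \<tau> n \<in> {0..T}" "\<tau> \<longlonglongrightarrow> t"
  let ?k = "duhamel_kernel S f"
  obtain M where M: "M \<ge> 0" "\<forall>t\<in>{0..T}. \<forall>x. norm (S t x) \<le> M * norm x"
    using C0_semigroup_bounded[OF S, of T] by (elim exE conjE)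
  note k = strongly_measurable_duhamel_kernel[OF S f]
  note ki = integrable_on_strongly_measurable[OF k integrable_norm_duhamel_kernel[OF S f]]
  have kd: "strongly_measurable (Leb T) (\<lambda>s. ?k (\<tau> n) s - ?k t s)" for n
    by (intro strongly_measurable_diff k)
  have bound: "norm (?k (\<tau> n) s - ?k t s) \<le> M * norm (f s) + M * norm (f s)" for n s
    using norm_duhamel_kernel_le[OF M(2,1)] \<tau>(1) t
    by (intro order_trans[OF norm_triangle_ineq4] add_mono) auto
  have int: "integrable (Leb T) (\<lambda>s. M * norm (f s) + M * norm (f s))"
    using L2_integrable_norm[OF f] by simp
  have intd: "integrable (Leb T) (\<lambda>s. norm (?k (\<tau> n) s - ?k t s))" for n
    by (rule integrable_norm_bound[OF kd int bound])
  have pt: "(\<lambda>n. ?k (\<tau> n) s) \<longlonglongrightarrow> ?k t s" if "s \<noteq> t" "s > 0" for s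
  proof (cases "s < t")
    case True
    have "eventually (\<lambda>n. s < \<tau> n) sequentially" using order_tendstoD(1)[OF \<tau>(2) True] .
    then have ev: "eventually (\<lambda>n. S (max 0 (\<tau> n - s)) (f s) = ?k (\<tau> n) s) sequentially"
      by eventually_elim (use that in \<open>simp add: duhamel_kernel_def\<close>)
    have "isCont (\<lambda>r. S (max 0 (r - s)) (f s)) t"
      by (rule continuous_on_interior[of UNIV])
         (intro C0_semigroup_continuous_compose[OF S] continuous_intros, simp)
    from isCont_tendsto_compose[OF this \<tau>(2)] ev
    have "(\<lambda>n. ?k (\<tau> n) s) \<longlonglongrightarrow> S (max 0 (t - s)) (f s)" by (rule Lim_transform_eventually)
    then show ?thesis using True that by (simp add: duhamel_kernel_def)
  next
    case False
    then have "t < s" using that by simp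
    then have "eventually (\<lambda>n. \<tau> n < s) sequentially" using order_tendstoD(2)[OF \<tau>(2)] by blast
    then have "eventually (\<lambda>n. 0 = ?k (\<tau> n) s) sequentially"
      by eventually_elim (simp add: duhamel_kernel_def)
    from Lim_transform_eventually[OF tendsto_const this]
    show ?thesis using \<open>t < s\<close> by (simp add: duhamel_kernel_def)
  qed
  have ne: "AE s in Leb T. s \<noteq> t"
  proof -
    have "AE s in lebesgue. s \<noteq> t"
      by (intro AE_completion AE_lborel_singleton)
    then show ?thesis by (subst AE_restrict_space_iff) auto
  qed
  have lim: "(\<lambda>n. LINT s|Leb T. norm (?k (\<tau> n) s - ?k t s)) \<longlonglongrightarrow> (LINT s|Leb T. 0)"
  proof (rule integral_dominated_convergence[OF _ _ int])
    show "AE s in Leb T. (\<lambda>n. norm (?k (\<tau> n) s - ?k t s)) \<longlonglongrightarrow> 0"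
      using ne AE_space
    proof eventually_elim
      case (elim s)
      then have "(\<lambda>n. norm (?k (\<tau> n) s - ?k t s)) \<longlonglongrightarrow> norm (?k t s - ?k t s)"
        by (intro tendsto_intros pt) auto
      then show ?case by simp
    qed
    show "AE s in Leb T. norm (norm (?k (\<tau> n) s - ?k t s)) \<le> M * norm (f s) + M * norm (f s)" for n
      by (rule AE_I2) (use bound in simp)
    show "(\<lambda>s. norm (?k (\<tau> n) s - ?k t s)) \<in> borel_measurable (Leb T)" for n
      by (rule borel_measurable_norm_strongly[OF kd])
  qed simp
  have "(\<lambda>n. duhamel S f (\<tau> n) - duhamel S f t) \<longlonglongrightarrow> 0"
  proof (rule Lim_null_comparison)
    show "(\<lambda>n. LINT s|Leb T. norm (?k (\<tau> n) s - ?k t s)) \<longlonglongrightarrow> 0" using lim by simp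
    have "norm (duhamel S f (\<tau> n) - duhamel S f t) \<le> (LINT s|Leb T. norm (?k (\<tau> n) s - ?k t s))" for n
    proof -
      have \<tau>n: "\<tau> n \<in> {0..T}" using \<tau>(1) by blast
      have "duhamel S f (\<tau> n) - duhamel S f t = integral {0..T} (\<lambda>s. ?k (\<tau> n) s - ?k t s)"
        unfolding duhamel_eq_integral_kernel[OF \<tau>n] duhamel_eq_integral_kernel[OF t]
        by (rule integral_diff[symmetric, OF ki[OF \<tau>n] ki[OF t]])
      then show ?thesis using norm_integral_le_LINT[OF kd intd] by simp
    qed
    then show "eventually (\<lambda>n. norm (duhamel S f (\<tau> n) - duhamel S f t)
        \<le> (LINT s|Leb T. norm (?k (\<tau> n) s - ?k t s))) sequentially" by simp
  qed
  then show "(duhamel S f \<circ> \<tau>) \<longlonglongrightarrow> duhamel S f t" by (simp add: o_def LIM_zero_iff)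
qed

lemma L2_cong:
  assumes f: "f \<in> L2 T" and eq: "\<And>s. s \<in> {0<..<T} \<Longrightarrow> f s = g s"
  shows "g \<in> L2 T"
proof -
  obtain s where s: "\<And>n::nat. simple_function (Leb T) (s n)" "AE x in Leb T. (\<lambda>n. s n x) \<longlonglongrightarrow> f x"
    using L2D(1)[OF f] unfolding strongly_measurable_def by blast
  have "AE x in Leb T. (\<lambda>n. s n x) \<longlonglongrightarrow> g x"
    using s(2) AE_space by eventually_elim (simp add: eq)
  then have "strongly_measurable (Leb T) g"
    unfolding strongly_measurable_def using s(1) by (intro exI[of _ s] conjI allI)
  moreover have "integrable (Leb T) (\<lambda>s. (norm (g s))\<^sup>2) = integrable (Leb T) (\<lambda>s. (norm (f s))\<^sup>2)"
    by (rule Bochner_Integration.integrable_cong) (auto simp: eq)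
  ultimately show ?thesis using L2D(2)[OF f] by (simp add: L2_def)
qed

lemma L2_inner_cong:
  assumes "\<And>s. s \<in> {0<..<T} \<Longrightarrow> f s = f' s" "\<And>s. s \<in> {0<..<T} \<Longrightarrow> g s = g' s"
  shows "L2_inner T f g = L2_inner T f' g'"
  unfolding L2_inner_def by (rule Bochner_Integration.integral_cong) (auto simp: assms)

lemma L2_continuous_on:
  assumes f: "continuous_on {0..T} f" and T: "T > 0"
  shows "f \<in> L2 T"
proof (rule L2_cong)
  show "(\<lambda>s. f (max 0 (min T s))) \<in> L2 T"
    by (intro L2_continuous continuous_on_compose2[OF f] continuous_intros) (use T in auto)
qed auto

lemma L2_duhamel:
  fixes S :: "real \<Rightarrow> 'h \<Rightarrow> 'h::banach"
  assumes "C0_semigroup S" "f \<in> L2 T" "T > 0"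
  shows "duhamel S f \<in> L2 T"
  by (intro L2_continuous_on continuous_on_duhamel assms)

lemma L2_orbit:
  fixes S :: "real \<Rightarrow> 'h \<Rightarrow> 'h::banach"
  assumes S: "C0_semigroup S"
  shows "(\<lambda>t. S t x) \<in> L2 T"
proof (rule L2_cong)
  show "(\<lambda>t. S (max 0 t) x) \<in> L2 T"
    by (intro L2_continuous C0_semigroup_continuous_compose[OF S] continuous_intros)
qed simp

lemma duhamel_sum:
  fixes S :: "real \<Rightarrow> 'h \<Rightarrow> 'h::banach"
  assumes S: "C0_semigroup S" and f: "\<And>i. i \<in> I \<Longrightarrow> f i \<in> L2 T" and t: "t \<in> {0..T}" and I: "finite I"
  shows "duhamel S (\<lambda>s. \<Sum>i\<in>I. c i *\<^sub>R f i s) t = (\<Sum>i\<in>I. c i *\<^sub>R duhamel S (f i) t)"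
proof -
  have lin: "linear (S (max 0 r))" for r
    using C0_semigroupD(1)[OF S, of "max 0 r"] by (simp add: bounded_linear.linear)
  have int: "duhamel_kernel S (f i) t integrable_on {0..T}" if "i \<in> I" for i
    by (rule integrable_on_strongly_measurable[OF strongly_measurable_duhamel_kernel[OF S f[OF that]]
          integrable_norm_duhamel_kernel[OF S f[OF that] t]])
  have "duhamel_kernel S (\<lambda>s. \<Sum>i\<in>I. c i *\<^sub>R f i s) t = (\<lambda>s. \<Sum>i\<in>I. c i *\<^sub>R duhamel_kernel S (f i) t s)"
  proof
    show "duhamel_kernel S (\<lambda>s. \<Sum>i\<in>I. c i *\<^sub>R f i s) t s = (\<Sum>i\<in>I. c i *\<^sub>R duhamel_kernel S (f i) t s)" for s
      by (cases "s \<in> {0..t}") (simp_all only: duhamel_kernel_def if_True if_False linear_sum[OF lin]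
          linear_scale[OF lin] scaleR_zero_right sum.neutral_const)
  qed
  then show ?thesis
    using int I by (simp add: duhamel_eq_integral_kernel[OF t] integral_sum integrable_cmul)
qed

lemma duhamel_uminus:
  fixes S :: "real \<Rightarrow> 'h \<Rightarrow> 'h::banach"
  assumes S: "C0_semigroup S" and f: "f \<in> L2 T" and t: "t \<in> {0..T}"
  shows "duhamel S (\<lambda>s. - f s) t = - duhamel S f t"
  using duhamel_sum[OF S, of "{0::nat}" "\<lambda>_. f" T t "\<lambda>_. -1"] f t by simp

lemma inner_duhamel:
  fixes S :: "real \<Rightarrow> 'h \<Rightarrow> 'h::{real_inner,banach}"
  assumes S: "C0_semigroup S" and f: "f \<in> L2 T" and t: "t \<in> {0..T}"
  shows "integrable (Leb T) (\<lambda>s. inner (duhamel_kernel S f t s) v)"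
    and "inner (duhamel S f t) v = (LINT s|Leb T. inner (duhamel_kernel S f t s) v)"
proof -
  note k = strongly_measurable_duhamel_kernel[OF S f, of t] integrable_norm_duhamel_kernel[OF S f t]
  show int: "integrable (Leb T) (\<lambda>s. inner (duhamel_kernel S f t s) v)"
  proof (rule Bochner_Integration.integrable_bound)
    show "integrable (Leb T) (\<lambda>s. norm (duhamel_kernel S f t s) * norm v)" using k(2) by simp
    show "(\<lambda>s. inner (duhamel_kernel S f t s) v) \<in> borel_measurable (Leb T)"
      by (intro borel_measurable_inner_strongly k strongly_measurable_simple_function simple_function_const)
    show "AE s in Leb T. norm (inner (duhamel_kernel S f t s) v) \<le> norm (norm (duhamel_kernel S f t s) * norm v)"
      by (rule AE_I2) (simp add: Cauchy_Schwarz_ineq2)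
  qed
  show "inner (duhamel S f t) v = (LINT s|Leb T. inner (duhamel_kernel S f t s) v)"
    unfolding LINT_Leb_eq_integral(2)[OF int] duhamel_eq_integral_kernel[OF t]
    by (rule inner_integral_left[OF integrable_on_strongly_measurable[OF k]])
qed

lemma LINT_reflect_Leb:
  fixes g :: "real \<Rightarrow> real"
  assumes "g \<in> borel_measurable (Leb T)"
  shows "(LINT s|Leb T. g (T - s)) = (LINT s|Leb T. g s)"
  using integral_distr[OF measurable_reflect_Leb assms] by (simp add: distr_reflect_Leb)

text \<open>
  Fubini's theorem for \<open>\<langle>S(t - s) f(s), w(t)\<rangle>\<close> on the triangle \<open>s \<le> t\<close>. This kernel is measurable as an
  everywhere limit of the functions \<open>kn n\<close>, built from simple functions of each variable, and it is
  dominated by \<open>M * norm (f s) * norm (w t)\<close>.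
\<close>

lemma duhamel_duality_simple:
  fixes S :: "real \<Rightarrow> 'h \<Rightarrow> 'h::{real_inner,banach}"
  assumes S: "C0_semigroup S" and f: "f \<in> L2 T" and w: "w \<in> L2 T"
    and s: "\<And>n::nat. simple_function (Leb T) (sf n)" "\<And>x. x \<in> {0<..<T} \<Longrightarrow> (\<lambda>n. sf n x) \<longlonglongrightarrow> f x"
    and r: "\<And>n::nat. simple_function (Leb T) (sw n)" "\<And>x. x \<in> {0<..<T} \<Longrightarrow> (\<lambda>n. sw n x) \<longlonglongrightarrow> w x"
  shows "(LINT t|Leb T. (LINT s|Leb T. inner (duhamel_kernel S f t s) (w t)))
       = (LINT s|Leb T. (LINT t|Leb T. inner (duhamel_kernel S f t s) (w t)))"
proof -
  interpret finite_measure "Leb T" by (rule finite_measure_Leb)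
  interpret pair_sigma_finite "Leb T" "Leb T" ..
  let ?P = "Leb T \<Otimes>\<^sub>M Leb T"
  obtain M where M: "M \<ge> 0" "\<forall>t\<in>{0..T}. \<forall>x. norm (S t x) \<le> M * norm x"
    using C0_semigroup_bounded[OF S, of T] by (elim exE conjE)
  define k where "k = (\<lambda>p. inner (duhamel_kernel S f (snd p) (fst p)) (w (snd p)))"
  define kn where "kn n p = (if fst p \<le> snd p then
      inner (S (max 0 (grid n (snd p) - grid n (fst p))) (sf n (fst p))) (sw n (snd p)) else 0)" for n p
  have [measurable]: "(\<lambda>p. fst p) \<in> borel_measurable ?P" "(\<lambda>p. snd p) \<in> borel_measurable ?P"
    using measurable_compose[OF measurable_fst, of id "Leb T" borel "Leb T"]
      measurable_compose[OF measurable_snd, of id "Leb T" borel "Leb T"] borel_measurable_Leb[of id T]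
    by (simp_all add: id_def)
  have kn: "kn n \<in> borel_measurable ?P" for n
  proof -
    have 1: "simple_function ?P (\<lambda>p. (grid n (fst p), sf n (fst p)))"
      by (intro simple_function_Pair simple_function_comp[OF measurable_fst] simple_function_grid s)
    have 2: "simple_function ?P (\<lambda>p. (grid n (snd p), sw n (snd p)))"
      by (intro simple_function_Pair simple_function_comp[OF measurable_snd] simple_function_grid r)
    have "simple_function ?P (\<lambda>p. inner (S (max 0 (grid n (snd p) - grid n (fst p))) (sf n (fst p))) (sw n (snd p)))"
      using simple_function_compose2[OF 1 2, where h = "\<lambda>a b. inner (S (max 0 (fst b - fst a)) (snd a)) (snd b)"]
      by simp
    note [measurable] = borel_measurable_simple_function[OF this]
    show ?thesis unfolding kn_def by measurable
  qed
  have k: "k \<in> borel_measurable ?P"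
  proof (rule borel_measurable_LIMSEQ_real[OF _ kn])
    fix p assume "p \<in> space ?P"
    then have p: "fst p \<in> {0<..<T}" "snd p \<in> {0<..<T}" by (auto simp: space_pair_measure)
    have "isCont (\<lambda>p. S (max 0 (fst p)) (snd p)) (snd p - fst p, f (fst p))"
      using C0_semigroup_jointly_continuous[OF S] by (simp add: continuous_on_eq_continuous_at)
    from isCont_tendsto_compose[OF this tendsto_Pair[OF tendsto_diff[OF grid_tendsto grid_tendsto] s(2)[OF p(1)]]]
    have "(\<lambda>n. S (max 0 (grid n (snd p) - grid n (fst p))) (sf n (fst p))) \<longlonglongrightarrow> S (max 0 (snd p - fst p)) (f (fst p))"
      by simp
    then have "(\<lambda>n. inner (S (max 0 (grid n (snd p) - grid n (fst p))) (sf n (fst p))) (sw n (snd p)))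
        \<longlonglongrightarrow> inner (S (max 0 (snd p - fst p)) (f (fst p))) (w (snd p))"
      by (intro tendsto_inner r(2) p)
    then show "(\<lambda>n. kn n p) \<longlonglongrightarrow> k p"
      using p by (cases "fst p \<le> snd p") (auto simp: kn_def k_def duhamel_kernel_def)
  qed
  have nf [measurable]: "(\<lambda>s. norm (f s)) \<in> borel_measurable (Leb T)"
    and nw [measurable]: "(\<lambda>s. norm (w s)) \<in> borel_measurable (Leb T)"
    using f w by (auto intro: borel_measurable_norm_strongly L2D)
  have prod: "integrable ?P (\<lambda>p. M * norm (f (fst p)) * norm (w (snd p)))"
  proof (rule Fubini_integrable)
    show "(\<lambda>p. M * norm (f (fst p)) * norm (w (snd p))) \<in> borel_measurable ?P" by measurable
    show "integrable (Leb T) (\<lambda>x. LINT y|Leb T. norm (M * norm (f (fst (x, y))) * norm (w (snd (x, y)))))"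
      using L2_integrable_norm[OF f] M(1) by (simp add: abs_mult)
    show "AE x in Leb T. integrable (Leb T) (\<lambda>y. M * norm (f (fst (x, y))) * norm (w (snd (x, y))))"
      using L2_integrable_norm[OF w] by simp
  qed
  have "integrable ?P k"
  proof (rule Bochner_Integration.integrable_bound[OF prod k], rule AE_I2)
    fix p assume "p \<in> space ?P"
    then have p: "snd p \<in> {0..T}" by (auto simp: space_pair_measure)
    have "\<bar>k p\<bar> \<le> norm (duhamel_kernel S f (snd p) (fst p)) * norm (w (snd p))"
      unfolding k_def by (rule Cauchy_Schwarz_ineq2)
    also have "\<dots> \<le> (M * norm (f (fst p))) * norm (w (snd p))"
      by (intro mult_right_mono norm_duhamel_kernel_le[OF M(2,1) p]) simp
    finally show "norm (k p) \<le> norm (M * norm (f (fst p)) * norm (w (snd p)))" using M(1) by simp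
  qed
  then have "integrable ?P (\<lambda>(s, t). inner (duhamel_kernel S f t s) (w t))"
    by (simp add: k_def split_def)
  from Fubini_integral[OF this] show ?thesis .
qed

lemma duhamel_cong_AE:
  fixes S :: "real \<Rightarrow> 'h \<Rightarrow> 'h::{real_inner,banach}"
  assumes S: "C0_semigroup S" and f: "f \<in> L2 T" and g: "g \<in> L2 T" and t: "t \<in> {0..T}"
    and eq: "L2_eq T f g"
  shows "duhamel S f t = duhamel S g t"
proof (rule eq_if_inner_eq)
  fix v
  have "inner (duhamel S f t) v = inner (duhamel S g t) v"
    unfolding inner_duhamel(2)[OF S f t] inner_duhamel(2)[OF S g t]
  proof (rule integral_cong_AE)
    show "AE s in Leb T. inner (duhamel_kernel S f t s) v = inner (duhamel_kernel S g t s) v"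
      using eq unfolding L2_eq_def by eventually_elim (simp add: duhamel_kernel_def)
  qed (use inner_duhamel(1)[OF S f t] inner_duhamel(1)[OF S g t] in auto)
  then show "inner v (duhamel S f t) = inner v (duhamel S g t)" by (simp add: inner_commute)
qed

lemma L2_representative:
  assumes f: "f \<in> L2 T"
  obtains f' s where "\<And>n::nat. simple_function (Leb T) (s n)"
    and "\<And>x. x \<in> {0<..<T} \<Longrightarrow> (\<lambda>n. s n x) \<longlonglongrightarrow> f' x" and "f' \<in> L2 T" and "L2_eq T f f'"
proof -
  obtain f' s where s: "\<And>n::nat. simple_function (Leb T) (s n)"
    "\<And>x. x \<in> space (Leb T) \<Longrightarrow> (\<lambda>n. s n x) \<longlonglongrightarrow> f' x" and eq: "AE x in Leb T. f x = f' x"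
    by (rule strongly_measurable_representative[OF L2D(1)[OF f]], rule that)
  have f': "strongly_measurable (Leb T) f'"
    unfolding strongly_measurable_def using s by (intro exI[of _ s] conjI allI AE_I2)
  note [measurable] = borel_measurable_norm_strongly[OF f']
  have "AE x in Leb T. (norm (f' x))\<^sup>2 = (norm (f x))\<^sup>2"
    using eq by eventually_elim simp
  then have "integrable (Leb T) (\<lambda>x. (norm (f' x))\<^sup>2)"
    using L2D(2)[OF f] by (subst integrable_cong_AE) (auto intro: borel_measurable_integrable)
  with f' have "f' \<in> L2 T" by (simp add: L2_def)
  then show thesis using that[of s f'] s eq by (simp add: L2_eq_def)
qed

text \<open>
  Both sides depend only on the classes of \<open>f\<close> and \<open>w\<close>, so representatives that are everywhere limits
  of simple functions may be used. The inner integral over \<open>t\<close> becomes a forward convolution with \<open>S\<^sup>*\<close>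
  after the substitution \<open>r = T - t\<close>.
\<close>

lemma duhamel_duality:
  fixes S :: "real \<Rightarrow> 'h \<Rightarrow> 'h::{real_inner,banach}"
  assumes S: "C0_semigroup S" and f0: "f \<in> L2 T" and w0: "w \<in> L2 T" and T: "T > 0"
  shows "L2_inner T (duhamel S f) w = L2_inner T f (\<lambda>s. duhamel (\<lambda>t. adjoint (S t)) (\<lambda>r. w (T - r)) (T - s))"
proof -
  let ?R = "\<lambda>t. adjoint (S t)"
  have R: "C0_semigroup ?R" by (rule C0_semigroup_adjoint[OF S])
  obtain f' sf where f': "\<And>n::nat. simple_function (Leb T) (sf n)"
    "\<And>x. x \<in> {0<..<T} \<Longrightarrow> (\<lambda>n. sf n x) \<longlonglongrightarrow> f' x" "f' \<in> L2 T" "L2_eq T f f'"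
    by (rule L2_representative[OF f0], rule that)
  obtain w' sw where w': "\<And>n::nat. simple_function (Leb T) (sw n)"
    "\<And>x. x \<in> {0<..<T} \<Longrightarrow> (\<lambda>n. sw n x) \<longlonglongrightarrow> w' x" "w' \<in> L2 T" "L2_eq T w w'"
    by (rule L2_representative[OF w0], rule that)
  let ?z = "\<lambda>w s. duhamel ?R (\<lambda>r. w (T - r)) (T - s)"
  have zL2: "?z w \<in> L2 T" if "w \<in> L2 T" for w
    by (rule L2_reflect[OF L2_duhamel[OF R L2_reflect[OF that] T]])
  have left: "L2_inner T (duhamel S f) w = L2_inner T (duhamel S f') w'"
  proof -
    have "L2_inner T (duhamel S f) w = L2_inner T (duhamel S f) w'"
      by (rule L2_inner_cong_right[OF L2_duhamel[OF S f0 T] w0 w'(3,4)])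
    also have "\<dots> = L2_inner T (duhamel S f') w'"
      by (rule L2_inner_cong) (auto intro!: duhamel_cong_AE[OF S f0 f'(3) _ f'(4)])
    finally show ?thesis .
  qed
  have right: "L2_inner T f (?z w) = L2_inner T f' (?z w')"
  proof -
    have "L2_eq T (\<lambda>r. w (T - r)) (\<lambda>r. w' (T - r))"
      unfolding L2_eq_def by (rule AE_reflect_Leb[OF w'(4)[unfolded L2_eq_def]])
    then have "L2_inner T f (?z w) = L2_inner T f (?z w')"
      by (intro L2_inner_cong) (auto intro!: duhamel_cong_AE[OF R L2_reflect[OF w0] L2_reflect[OF w'(3)]])
    also have "\<dots> = L2_inner T (?z w') f" by (rule L2_inner_commute)
    also have "\<dots> = L2_inner T (?z w') f'"
      by (rule L2_inner_cong_right[OF zL2[OF w'(3)] f0 f'(3,4)])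
    finally show ?thesis by (simp add: L2_inner_commute)
  qed
  have "L2_inner T (duhamel S f') w' = (LINT t|Leb T. (LINT s|Leb T. inner (duhamel_kernel S f' t s) (w' t)))"
    unfolding L2_inner_def
    by (rule Bochner_Integration.integral_cong) (auto intro!: inner_duhamel(2)[OF S f'(3)])
  also have "\<dots> = (LINT s|Leb T. (LINT t|Leb T. inner (duhamel_kernel S f' t s) (w' t)))"
    by (rule duhamel_duality_simple[OF S f'(3) w'(3) f'(1,2) w'(1,2)])
  also have "\<dots> = L2_inner T f' (?z w')"
    unfolding L2_inner_def
  proof (rule Bochner_Integration.integral_cong)
    fix s assume "s \<in> space (Leb T)"
    then have s: "s \<in> {0<..<T}" by simp
    then have Ts: "T - s \<in> {0..T}" by auto
    let ?h = "\<lambda>r. inner (duhamel_kernel ?R (\<lambda>r. w' (T - r)) (T - s) r) (f' s)"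
    have int: "integrable (Leb T) ?h" by (rule inner_duhamel(1)[OF R L2_reflect[OF w'(3)] Ts])
    have "inner (f' s) (?z w' s) = (LINT r|Leb T. ?h r)"
      using inner_duhamel(2)[OF R L2_reflect[OF w'(3)] Ts, of "f' s"] by (simp add: inner_commute)
    also have "\<dots> = (LINT t|Leb T. ?h (T - t))"
      by (rule LINT_reflect_Leb[OF borel_measurable_integrable[OF int], symmetric])
    also have "\<dots> = (LINT t|Leb T. inner (duhamel_kernel S f' t s) (w' t))"
    proof (rule Bochner_Integration.integral_cong)
      fix t assume "t \<in> space (Leb T)"
      then have t: "t \<in> {0<..<T}" by simp
      show "?h (T - t) = inner (duhamel_kernel S f' t s) (w' t)"
        using s t inner_adjoint[OF C0_semigroupD(1)[OF S, of "t - s"], of "f' s" "w' t"]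
        by (auto simp: duhamel_kernel_def inner_commute)
    qed simp
    finally show "(LINT t|Leb T. inner (duhamel_kernel S f' t s) (w' t)) = inner (f' s) (?z w' s)" ..
  qed simp
  finally show ?thesis using left right by simp
qed

section \<open>Finitely many linear constraints\<close>

text \<open>
  The criterion for solving finitely many linear equations: \<open>R\<close> is the subspace of attained values and
  \<open>r\<close> the prescribed value. By induction on \<open>N\<close>, either the last coordinate vanishes on \<open>R\<close>, or a pivot
  \<open>p \<in> R\<close> with last coordinate \<open>1\<close> eliminates it.
\<close>

lemma moments_solvable:
  fixes R :: "(nat \<Rightarrow> real) set" and r :: "nat \<Rightarrow> real"
  assumes R: "(\<lambda>i. 0) \<in> R" "\<And>x y a b. x \<in> R \<Longrightarrow> y \<in> R \<Longrightarrow> (\<lambda>i. a * x i + b * y i) \<in> R"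
    and ann: "\<And>c. (\<forall>x\<in>R. (\<Sum>i<N. c i * x i) = 0) \<Longrightarrow> (\<Sum>i<N. c i * r i) = 0"
  shows "\<exists>x\<in>R. \<forall>i<N. x i = r i"
  using assms
proof (induction N arbitrary: R r)
  case 0
  then show ?case by auto
next
  case (Suc N)
  show ?case
  proof (cases "\<forall>x\<in>R. x N = 0")
    case True
    have rN: "r N = 0"
      using Suc.prems(3)[of "\<lambda>i. if i = N then 1 else 0"] True by simp
    have "\<exists>x\<in>R. \<forall>i<N. x i = r i"
    proof (rule Suc.IH[OF Suc.prems(1,2)])
      fix c assume c: "\<forall>x\<in>R. (\<Sum>i<N. c i * x i) = 0"
      then show "(\<Sum>i<N. c i * r i) = 0"
        using Suc.prems(3)[of c] True rN by simp
    qed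
    then show ?thesis using True rN by (auto simp: less_Suc_eq)
  next
    case False
    then obtain q where q: "q \<in> R" "q N \<noteq> 0" by blast
    define p where "p = (\<lambda>i. q i / q N)"
    have "(\<lambda>i. (1 / q N) * q i + 0 * q i) \<in> R" by (rule Suc.prems(2)[OF q(1) q(1)])
    then have p: "p \<in> R" "p N = 1" using q by (simp_all add: p_def)
    have "\<exists>x\<in>{x \<in> R. x N = 0}. \<forall>i<N. x i = r i - r N * p i"
    proof (rule Suc.IH)
      show "(\<lambda>i. 0) \<in> {x \<in> R. x N = 0}" using Suc.prems(1) by simp
      show "(\<lambda>i. a * x i + b * y i) \<in> {x \<in> R. x N = 0}"
        if "x \<in> {x \<in> R. x N = 0}" "y \<in> {x \<in> R. x N = 0}" for x y a b
        using that Suc.prems(2) by simp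
      fix c assume c: "\<forall>x\<in>{x \<in> R. x N = 0}. (\<Sum>i<N. c i * x i) = 0"
      \<comment> \<open>The last coefficient is chosen so that \<open>c'\<close> annihilates the pivot too, hence all of \<open>R\<close>.\<close>
      define c' where "c' = (\<lambda>i. if i = N then - (\<Sum>j<N. c j * p j) else c i)"
      have c': "(\<Sum>i<Suc N. c' i * x i) = (\<Sum>i<N. c i * x i) - (\<Sum>j<N. c j * p j) * x N" for x
        by (simp add: c'_def)
      have "(\<Sum>i<Suc N. c' i * x i) = 0" if x: "x \<in> R" for x
      proof -
        have "(\<lambda>i. 1 * x i + (- x N) * p i) \<in> {x \<in> R. x N = 0}"
          using Suc.prems(2)[OF x p(1), of 1 "- x N"] p(2) by simp
        from c[rule_format, OF this]
        have "(\<Sum>i<N. c i * x i) - x N * (\<Sum>i<N. c i * p i) = 0"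
          by (simp add: algebra_simps sum_subtractf sum_distrib_left)
        then show ?thesis unfolding c' by (simp add: mult.commute)
      qed
      then have "(\<Sum>i<Suc N. c' i * r i) = 0" using Suc.prems(3)[of c'] by blast
      then show "(\<Sum>i<N. c i * (r i - r N * p i)) = 0"
        unfolding c' by (simp add: algebra_simps sum_subtractf sum_distrib_left)
    qed
    then obtain x where x: "x \<in> R" "x N = 0" "\<And>i. i < N \<Longrightarrow> x i = r i - r N * p i" by blast
    have "(\<lambda>i. 1 * x i + r N * p i) \<in> R" by (rule Suc.prems(2)[OF x(1) p(1)])
    moreover have "1 * x i + r N * p i = r i" if "i < Suc N" for i
      using that x p(2) by (cases "i = N") auto
    ultimately show ?thesis
      by (intro bexI[of _ "\<lambda>i. 1 * x i + r N * p i"] allI impI)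
  qed
qed

section \<open>Controllability and observability\<close>

locale control_system =
  fixes S :: "real \<Rightarrow> 'h \<Rightarrow> 'h::{real_inner,banach}"
    and B :: "'u::{real_inner,banach} \<Rightarrow> 'h"
    and T :: real
  assumes semigroup: "C0_semigroup S" and bounded_B: "bounded_linear B" and T_pos: "T > 0"
begin

abbreviation S_adj :: "real \<Rightarrow> 'h \<Rightarrow> 'h" where
  "S_adj t \<equiv> adjoint (S t)"

lemma semigroup_adj: "C0_semigroup S_adj"
  by (rule C0_semigroup_adjoint[OF semigroup])

text \<open>
  The operator \<open>u \<mapsto> steer u T\<close> is the end-point map and \<open>observe\<close> is its adjoint. The operator
  \<open>backward\<close> is the adjoint of \<open>duhamel S\<close>: \<open>backward w s\<close> equals \<open>\<integral>\<^sub>s\<^sup>T S\<^sup>*(r - s) w(r) dr\<close>, written as a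
  forward convolution in reversed time, so \<open>- backward w\<close> is the mild solution of \<open>z' + A\<^sup>* z = w\<close>,
  \<open>z(T) = 0\<close>.
\<close>

definition steer :: "(real \<Rightarrow> 'u) \<Rightarrow> real \<Rightarrow> 'h" where
  "steer u = duhamel S (\<lambda>s. B (u s))"

definition observe :: "'h \<Rightarrow> real \<Rightarrow> 'u" where
  "observe x s = adjoint B (S_adj (T - s) x)"

definition backward :: "(real \<Rightarrow> 'h) \<Rightarrow> real \<Rightarrow> 'h" where
  "backward w s = duhamel S_adj (\<lambda>r. w (T - r)) (T - s)"

lemma L2_Bu: "u \<in> L2 T \<Longrightarrow> (\<lambda>s. B (u s)) \<in> L2 T"
  by (rule L2_bounded_linear_image[OF _ bounded_B])

lemma L2_steer: "u \<in> L2 T \<Longrightarrow> steer u \<in> L2 T"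
  unfolding steer_def by (intro L2_duhamel semigroup L2_Bu T_pos)

lemma L2_observe: "observe x \<in> L2 T"
  unfolding observe_def
  by (rule L2_bounded_linear_image[OF L2_reflect[OF L2_orbit[OF semigroup_adj]] bounded_linear_adjoint[OF bounded_B]])

lemma L2_backward: "w \<in> L2 T \<Longrightarrow> backward w \<in> L2 T"
  unfolding backward_def by (intro L2_reflect[where f = "duhamel S_adj _"] L2_duhamel semigroup_adj T_pos L2_reflect)

lemma L2_adjoint_B_backward: "w \<in> L2 T \<Longrightarrow> (\<lambda>s. adjoint B (backward w s)) \<in> L2 T"
  by (rule L2_bounded_linear_image[OF L2_backward bounded_linear_adjoint[OF bounded_B]])

lemma inner_steer_end:
  assumes u: "u \<in> L2 T"
  shows "inner (steer u T) x = L2_inner T u (observe x)"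
proof -
  have "inner (steer u T) x = (LINT s|Leb T. inner (duhamel_kernel S (\<lambda>s. B (u s)) T s) x)"
    unfolding steer_def using T_pos by (intro inner_duhamel(2)[OF semigroup L2_Bu[OF u]]) simp
  also have "\<dots> = L2_inner T u (observe x)"
    unfolding L2_inner_def
  proof (rule Bochner_Integration.integral_cong)
    fix s assume "s \<in> space (Leb T)"
    then have s: "s \<in> {0<..<T}" by simp
    then show "inner (duhamel_kernel S (\<lambda>s. B (u s)) T s) x = inner (u s) (observe x s)"
      using inner_adjoint[OF C0_semigroupD(1)[OF semigroup, of "T - s"], of "B (u s)" x]
        inner_adjoint[OF bounded_B, of "u s" "S_adj (T - s) x"]
      by (simp add: duhamel_kernel_def observe_def)
  qed simp
  finally show ?thesis .
qed

lemma L2_inner_steer: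
  assumes u: "u \<in> L2 T" and w: "w \<in> L2 T"
  shows "L2_inner T (steer u) w = L2_inner T u (\<lambda>s. adjoint B (backward w s))"
proof -
  have "L2_inner T (steer u) w = L2_inner T (\<lambda>s. B (u s)) (backward w)"
    unfolding steer_def backward_def by (rule duhamel_duality[OF semigroup L2_Bu[OF u] w T_pos])
  then show ?thesis by (simp add: L2_inner_def inner_adjoint[OF bounded_B])
qed

lemma steer_end_diff:
  assumes "u \<in> L2 T" "v \<in> L2 T"
  shows "steer (\<lambda>s. u s - v s) T = steer u T - steer v T"
proof (rule eq_if_inner_eq)
  fix x
  have "inner (steer (\<lambda>s. u s - v s) T) x = inner (steer u T - steer v T) x"
    using assms by (simp add: inner_steer_end L2_diff L2_observe L2_inner_diff_left inner_diff_left)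
  then show "inner x (steer (\<lambda>s. u s - v s) T) = inner x (steer u T - steer v T)"
    by (simp add: inner_commute)
qed

lemma observe_linear:
  assumes "s \<le> T"
  shows "observe (x + y) s = observe x s + observe y s" "observe (c *\<^sub>R x) s = c *\<^sub>R observe x s"
  using assms bounded_linear_adjoint[OF bounded_B] C0_semigroupD(1)[OF semigroup_adj, of "T - s"]
  by (simp_all add: observe_def linear_simps)

lemma observe_bounded: "\<exists>K\<ge>0. \<forall>x. \<forall>s\<in>{0..T}. norm (observe x s) \<le> K * norm x"
proof -
  obtain K where K: "K \<ge> 0" "\<And>x. norm (adjoint B x) \<le> norm x * K"
    using bounded_linear.nonneg_bounded[OF bounded_linear_adjoint[OF bounded_B]] by blast
  obtain M where M: "M \<ge> 0" "\<forall>t\<in>{0..T}. \<forall>x. norm (S_adj t x) \<le> M * norm x"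
    using C0_semigroup_bounded[OF semigroup_adj, of T] by (elim exE conjE)
  have "norm (observe x s) \<le> (M * K) * norm x" if s: "s \<in> {0..T}" for x s
  proof -
    have "norm (observe x s) \<le> norm (S_adj (T - s) x) * K" unfolding observe_def by (rule K(2))
    also have "\<dots> \<le> (M * norm x) * K" using M s K by (intro mult_right_mono) auto
    finally show ?thesis by (simp add: mult_ac)
  qed
  then show ?thesis using K M by (intro exI[of _ "M * K"]) simp
qed

definition gramian :: "'h \<Rightarrow> 'h" where
  "gramian x = steer (observe x) T"

lemma inner_gramian: "inner (gramian x) y = L2_inner T (observe x) (observe y)"
  unfolding gramian_def by (rule inner_steer_end[OF L2_observe])

lemma bounded_linear_gramian: "bounded_linear gramian"
proof -
  obtain K where K: "K \<ge> 0" "\<And>x s. s \<in> {0..T} \<Longrightarrow> norm (observe x s) \<le> K * norm x"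
    using observe_bounded by blast
  interpret finite_measure "Leb T" by (rule finite_measure_Leb)
  have T: "measure (Leb T) {0<..<T} = T"
    using T_pos by (simp add: measure_restrict_space)
  show ?thesis
  proof (rule bounded_linear_intro[where K = "K * K * T"])
    show "gramian (x + y) = gramian x + gramian y" for x y
    proof (rule eq_if_inner_eq)
      fix v
      have "L2_inner T (observe (x + y)) (observe v) = L2_inner T (\<lambda>s. observe x s + observe y s) (observe v)"
        by (rule L2_inner_cong) (auto simp: observe_linear)
      then show "inner v (gramian (x + y)) = inner v (gramian x + gramian y)"
        by (simp add: inner_commute[of v] inner_gramian inner_add_left L2_inner_add_left L2_observe)
    qed
    show "gramian (c *\<^sub>R x) = c *\<^sub>R gramian x" for c x
    proof (rule eq_if_inner_eq)
      fix v
      have "L2_inner T (observe (c *\<^sub>R x)) (observe v) = L2_inner T (\<lambda>s. c *\<^sub>R observe x s) (observe v)"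
        by (rule L2_inner_cong) (auto simp: observe_linear)
      then show "inner v (gramian (c *\<^sub>R x)) = inner v (c *\<^sub>R gramian x)"
        by (simp add: inner_commute[of v] inner_gramian L2_inner_scaleR_left)
    qed
    show "norm (gramian x) \<le> norm x * (K * K * T)" for x
    proof (rule norm_le_if_inner_le)
      fix v
      have "\<bar>inner v (gramian x)\<bar> = \<bar>LINT s|Leb T. inner (observe x s) (observe v s)\<bar>"
        by (simp add: inner_commute[of v] inner_gramian L2_inner_def)
      also have "\<dots> \<le> (LINT s|Leb T. (K * norm x) * (K * norm v))"
      proof (rule integral_abs_bound_integral)
        show "integrable (Leb T) (\<lambda>s. inner (observe x s) (observe v s))"
          by (intro L2_integrable_inner L2_observe)
        fix s assume "s \<in> space (Leb T)"
        then have s: "s \<in> {0..T}" by simp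
        have "\<bar>inner (observe x s) (observe v s)\<bar> \<le> norm (observe x s) * norm (observe v s)"
          by (rule Cauchy_Schwarz_ineq2)
        also have "\<dots> \<le> (K * norm x) * (K * norm v)"
          using K s by (intro mult_mono) auto
        finally show "\<bar>inner (observe x s) (observe v s)\<bar> \<le> (K * norm x) * (K * norm v)" .
      qed simp
      also have "\<dots> = norm x * (K * K * T) * norm v" using T by simp
      finally show "\<bar>inner v (gramian x)\<bar> \<le> norm x * (K * K * T) * norm v" .
    qed (use K T_pos in simp)
  qed
qed

end

locale observable_system = control_system +
  fixes C :: real
  assumes C_pos: "C > 0" and observability: "\<And>x. norm x \<le> C * L2_norm T (observe x)"
begin

text \<open>
  Coercivity of the Gramian is the observability inequality, squared.
\<close>

lemma gramian_surj: "\<exists>x. gramian x = y"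
proof (rule Lax_Milgram[OF bounded_linear_gramian])
  show "1 / C\<^sup>2 > 0" using C_pos by simp
  show "1 / C\<^sup>2 * (norm x)\<^sup>2 \<le> inner (gramian x) x" for x
  proof -
    have "(norm x)\<^sup>2 \<le> (C * L2_norm T (observe x))\<^sup>2"
      by (intro power_mono observability) simp
    also have "\<dots> = C\<^sup>2 * inner (gramian x) x"
      by (simp add: power_mult_distrib L2_norm_square inner_gramian)
    finally show ?thesis using C_pos by (simp add: field_simps)
  qed
qed

text \<open>
  The annihilator of the kernel of the end-point map is the range of its adjoint. Surjectivity of the
  Gramian splits \<open>f = observe x + u\<close> with \<open>u\<close> a null control; then \<open>u\<close> is orthogonal to \<open>f\<close> by
  assumption and to \<open>observe x\<close> by duality, hence to itself.
\<close>

lemma annihilator_of_null_controls: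
  assumes f: "f \<in> L2 T"
    and orth: "\<And>u. u \<in> L2 T \<Longrightarrow> steer u T = 0 \<Longrightarrow> L2_inner T u f = 0"
  shows "\<exists>x. L2_eq T f (observe x)"
proof -
  obtain x where x: "gramian x = steer f T" using gramian_surj by blast
  define u where "u = (\<lambda>s. f s - observe x s)"
  have u: "u \<in> L2 T" unfolding u_def by (rule L2_diff[OF f L2_observe])
  have 0: "steer u T = 0"
    unfolding u_def using x by (simp add: steer_end_diff[OF f L2_observe] gramian_def)
  have "L2_inner T u u = L2_inner T u f - L2_inner T u (observe x)"
    by (subst (2) u_def) (rule L2_inner_diff_right[OF f L2_observe u])
  also have "\<dots> = 0" using orth[OF u 0] inner_steer_end[OF u, of x] 0 by simp
  finally have "L2_eq T u (\<lambda>s. 0)" by (rule L2_eq_zero_if_inner_zero[OF u])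
  then have "L2_eq T f (observe x)"
    unfolding L2_eq_def by eventually_elim (simp add: u_def)
  then show ?thesis ..
qed

text \<open>
  This is \<open>moments_solvable\<close> for the subspace of all moment vectors of null controls; the linear
  relations that hold on it are described by \<open>annihilator_of_null_controls\<close>.
\<close>

lemma null_control_with_moments:
  fixes N :: nat
  assumes p: "\<And>i. i < N \<Longrightarrow> p i \<in> L2 T"
    and compat: "\<And>c x. L2_eq T (\<lambda>s. \<Sum>i<N. c i *\<^sub>R p i s) (observe x) \<Longrightarrow> (\<Sum>i<N. c i * r i) = 0"
  shows "\<exists>u\<in>L2 T. steer u T = 0 \<and> (\<forall>i<N. L2_inner T u (p i) = r i)"
proof -
  define R where "R = {x. \<exists>u\<in>L2 T. steer u T = 0 \<and> (\<forall>i<N. x i = L2_inner T u (p i))}"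
  have steer0: "steer (\<lambda>s. 0) T = 0"
    using steer_end_diff[OF L2_zero L2_zero] by simp
  have "\<exists>x\<in>R. \<forall>i<N. x i = r i"
  proof (rule moments_solvable)
    show "(\<lambda>i. 0) \<in> R"
      unfolding R_def using steer0 L2_zero by (auto simp: L2_inner_def intro!: bexI[of _ "\<lambda>s. 0"])
    show "(\<lambda>i. a * x i + b * y i) \<in> R" if xy: "x \<in> R" "y \<in> R" for x y a b
    proof -
      obtain u v where u: "u \<in> L2 T" "steer u T = 0" "\<And>i. i < N \<Longrightarrow> x i = L2_inner T u (p i)"
        and v: "v \<in> L2 T" "steer v T = 0" "\<And>i. i < N \<Longrightarrow> y i = L2_inner T v (p i)"
        using xy unfolding R_def by blast
      let ?w = "\<lambda>s. a *\<^sub>R u s + b *\<^sub>R v s"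
      have w: "?w \<in> L2 T" using u v by (intro L2_add L2_scaleR)
      have inner_w: "L2_inner T ?w q = a * L2_inner T u q + b * L2_inner T v q" if "q \<in> L2 T" for q
        using that u v by (simp add: L2_inner_add_left L2_scaleR L2_inner_scaleR_left)
      have "inner (steer ?w T) z = 0" for z
        using inner_w[OF L2_observe, of z] u v by (simp add: inner_steer_end[OF w] flip: inner_steer_end)
      then have "steer ?w T = 0" by (metis inner_eq_zero_iff)
      then show ?thesis
        unfolding R_def using w inner_w[OF p] u v by (auto intro!: bexI[of _ ?w])
    qed
    fix c assume c: "\<forall>x\<in>R. (\<Sum>i<N. c i * x i) = 0"
    let ?f = "\<lambda>s. \<Sum>i<N. c i *\<^sub>R p i s"
    have f: "?f \<in> L2 T" using p by (intro L2_sum L2_scaleR) simp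
    have "L2_inner T u ?f = 0" if u: "u \<in> L2 T" "steer u T = 0" for u
    proof -
      have "(\<lambda>i. L2_inner T u (p i)) \<in> R" using u unfolding R_def by auto
      from c[rule_format, OF this] show ?thesis using L2_inner_sum_right[OF u(1), of "{..<N}" p c] p by simp
    qed
    then obtain x where "L2_eq T ?f (observe x)"
      using annihilator_of_null_controls[OF f] by blast
    then show "(\<Sum>i<N. c i * r i) = 0" by (rule compat)
  qed
  then show ?thesis unfolding R_def by auto
qed

end

section \<open>Prescribing the projections\<close>

lemma L2_closed_subspaceD:
  assumes "L2_closed_subspace T V"
  shows "f \<in> V \<Longrightarrow> f \<in> L2 T" "(\<lambda>t. 0) \<in> V"
    "f \<in> V \<Longrightarrow> g \<in> V \<Longrightarrow> (\<lambda>t. f t + g t) \<in> V" "f \<in> V \<Longrightarrow> (\<lambda>t. c *\<^sub>R f t) \<in> V"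
  using assms unfolding L2_closed_subspace_def by auto

lemma L2_closed_subspace_sum:
  assumes V: "L2_closed_subspace T V" and e: "\<And>i. i < (n::nat) \<Longrightarrow> e i \<in> V"
  shows "(\<lambda>t. \<Sum>i<n. c i *\<^sub>R e i t) \<in> V"
  using e
proof (induction n)
  case 0
  then show ?case by (simp add: L2_closed_subspaceD(2)[OF V])
next
  case (Suc n)
  have "(\<lambda>t. (\<Sum>i<n. c i *\<^sub>R e i t) + c n *\<^sub>R e n t) \<in> V"
    by (intro L2_closed_subspaceD(3)[OF V] L2_closed_subspaceD(4)[OF V]) (simp_all add: Suc)
  then show ?case by simp
qed

lemma L2_projectionI_spanning:
  assumes V: "L2_closed_subspace T V" and e: "\<And>i. i < (n::nat) \<Longrightarrow> e i \<in> V"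
    and span: "\<And>f. f \<in> V \<Longrightarrow> \<exists>c. L2_eq T f (\<lambda>t. \<Sum>i<n. c i *\<^sub>R e i t)"
    and f: "f \<in> L2 T" and p: "p \<in> V"
    and orth: "\<And>i. i < n \<Longrightarrow> L2_inner T f (e i) = L2_inner T p (e i)"
  shows "L2_projection T V f p"
proof -
  have VL2: "v \<in> L2 T" if "v \<in> V" for v using L2_closed_subspaceD(1)[OF V that] .
  have d: "(\<lambda>t. f t - p t) \<in> L2 T" by (rule L2_diff[OF f VL2[OF p]])
  have "L2_inner T (\<lambda>t. f t - p t) v = 0" if v: "v \<in> V" for v
  proof -
    obtain c where c: "L2_eq T v (\<lambda>t. \<Sum>i<n. c i *\<^sub>R e i t)" using span[OF v] by blast
    have "L2_inner T (\<lambda>t. f t - p t) v = L2_inner T (\<lambda>t. f t - p t) (\<lambda>t. \<Sum>i<n. c i *\<^sub>R e i t)"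
      by (rule L2_inner_cong_right[OF d VL2[OF v] VL2[OF L2_closed_subspace_sum[OF V e]] c])
    also have "\<dots> = (\<Sum>i<n. c i * L2_inner T (\<lambda>t. f t - p t) (e i))"
      using e VL2 by (intro L2_inner_sum_right d) auto
    also have "\<dots> = 0"
      using e VL2 f p orth by (intro sum.neutral) (simp add: L2_inner_diff_left)
    finally show ?thesis .
  qed
  with f p show ?thesis by (simp add: L2_projection_def)
qed

lemma sum_split_lessThan:
  fixes f :: "nat \<Rightarrow> 'a::comm_monoid_add"
  shows "(\<Sum>i<n + m. f i) = (\<Sum>i<n. f i) + (\<Sum>j<m. f (n + j))"
  by (induction m) (auto simp: add.assoc)

theorem theorem1p2:
  fixes A :: "('h::{real_inner,banach} \<times> 'h) set"
    and B :: "'u::{real_inner,banach} \<Rightarrow> 'h"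
    and T :: real
    and G :: "(real \<Rightarrow> 'u) set"
    and W :: "(real \<Rightarrow> 'h) set"
  assumes "\<exists>S. generates A S"
    and "bounded_linear B"
    and "T > 0"
    and "L2_closed_subspace T G"
    and "L2_closed_subspace T W"
    and unique_continuation:
      "\<And>zT g w z. g \<in> G \<Longrightarrow> w \<in> W \<Longrightarrow>
         backward_mild_solution (adjoint_op A) T w zT z \<Longrightarrow>
         L2_eq T (\<lambda>t. adjoint B (z t)) g \<Longrightarrow>
         zT = 0 \<and> L2_eq T g (\<lambda>t. 0) \<and> L2_eq T w (\<lambda>t. 0)"
    and observability:
      "\<exists>C>0. \<forall>zT z. backward_mild_solution (adjoint_op A) T (\<lambda>t. 0) zT z \<longrightarrow>
         norm zT \<le> C * L2_norm T (\<lambda>t. adjoint B (z t))"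
    and "L2_finite_dim T G"
    and "L2_finite_dim T W"
  shows "\<forall>y0 y1. \<forall>g\<in>G. \<forall>w\<in>W. \<exists>u\<in>L2 T. L2_projection T G u g \<and>
           (\<exists>y. mild_solution A T (\<lambda>t. B (u t)) y0 y \<and> y T = y1 \<and> L2_projection T W y w)"
proof (intro allI ballI)
  fix y0 y1 gs ws assume gs: "gs \<in> G" and ws: "ws \<in> W"
  note G = \<open>L2_closed_subspace T G\<close> and W = \<open>L2_closed_subspace T W\<close>
  obtain S where gen: "generates A S" using assms(1) by blast
  then have S: "C0_semigroup S" by (simp add: generates_def)
  interpret control_system S B T
    by (rule control_system.intro[OF S assms(2,3)])
  have gen_adj: "generates (adjoint_op A) S_adj" by (rule generates_adjoint[OF gen])
  obtain C where C: "C > 0" "\<And>zT z. backward_mild_solution (adjoint_op A) T (\<lambda>t. 0) zT z \<Longrightarrow>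
         norm zT \<le> C * L2_norm T (\<lambda>t. adjoint B (z t))"
    using observability by blast
  interpret observable_system S B T C
  proof unfold_locales
    show "norm x \<le> C * L2_norm T (observe x)" for x
    proof -
      have no_source: "integral {0..t} (\<lambda>s. S_adj (t - s) 0) = 0" for t
      proof -
        have "integral {0..t} (\<lambda>s. S_adj (t - s) 0) = integral {0..t} (\<lambda>s. 0)"
        proof (rule integral_cong)
          fix s assume "s \<in> {0..t}"
          then show "S_adj (t - s) 0 = 0"
            using C0_semigroupD(1)[OF semigroup_adj, of "t - s"] by (simp add: linear_simps)
        qed
        then show ?thesis by simp
      qed
      have "backward_mild_solution (adjoint_op A) T (\<lambda>t. 0) x (\<lambda>t. S_adj (T - t) x)"
        unfolding backward_mild_solution_def mild_solution_def
        using gen_adj by (intro exI[of _ S_adj]) (simp add: no_source)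
      from C(2)[OF this] show ?thesis by (simp add: observe_def[abs_def])
    qed
  qed (rule C(1))
  obtain n e where e: "\<And>i. i < (n::nat) \<Longrightarrow> e i \<in> G"
      "\<And>f. f \<in> G \<Longrightarrow> \<exists>c. L2_eq T f (\<lambda>t. \<Sum>i<n. c i *\<^sub>R e i t)"
    using \<open>L2_finite_dim T G\<close> unfolding L2_finite_dim_def by blast
  obtain m h where h: "\<And>i. i < (m::nat) \<Longrightarrow> h i \<in> W"
      "\<And>f. f \<in> W \<Longrightarrow> \<exists>c. L2_eq T f (\<lambda>t. \<Sum>i<m. c i *\<^sub>R h i t)"
    using \<open>L2_finite_dim T W\<close> unfolding L2_finite_dim_def by blast
  have GL2: "f \<in> G \<Longrightarrow> f \<in> L2 T" for f by (rule L2_closed_subspaceD(1)[OF G])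
  have WL2: "f \<in> W \<Longrightarrow> f \<in> L2 T" for f by (rule L2_closed_subspaceD(1)[OF W])
  obtain x1 where x1: "gramian x1 = y1 - S T y0" using gramian_surj by blast
  define u1 where "u1 = observe x1"
  have u1: "u1 \<in> L2 T" "steer u1 T = y1 - S T y0"
    using x1 L2_observe by (simp_all add: u1_def gramian_def)
  let ?y0 = "\<lambda>t. S t y0"
  have y0: "?y0 \<in> L2 T" by (rule L2_orbit[OF S])
  let ?\<psi> = "\<lambda>w s. adjoint B (backward w s)"
  define p where "p i = (if i < n then e i else ?\<psi> (h (i - n)))" for i
  \<comment> \<open>The moments that a null control must have to correct \<open>u1\<close> and its trajectory, which is
    \<open>S t y0 + steer u1 t\<close>; the part \<open>steer u1\<close> is expressed by its moments against \<open>?\<psi> (h j)\<close>.\<close>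
  define r where "r i = (if i < n then L2_inner T gs (e i) - L2_inner T u1 (e i)
      else L2_inner T ws (h (i - n)) - L2_inner T ?y0 (h (i - n)) - L2_inner T u1 (?\<psi> (h (i - n))))" for i
  have p: "p i \<in> L2 T" if "i < n + m" for i
    using that e h GL2 WL2 by (simp add: p_def L2_adjoint_B_backward)
  have compat: "(\<Sum>i<n + m. c i * r i) = 0" if cx: "L2_eq T (\<lambda>s. \<Sum>i<n + m. c i *\<^sub>R p i s) (observe x)" for c x
  proof -
    define g where "g = (\<lambda>s. \<Sum>i<n. c i *\<^sub>R e i s)"
    define w where "w = (\<lambda>s. \<Sum>j<m. c (n + j) *\<^sub>R h j s)"
    have g: "g \<in> G" unfolding g_def by (rule L2_closed_subspace_sum[OF G e(1)])
    have w: "w \<in> W" unfolding w_def by (rule L2_closed_subspace_sum[OF W h(1)])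
    have bw: "backward w s = (\<Sum>j<m. c (n + j) *\<^sub>R backward (h j) s)" if "s \<in> {0..T}" for s
      unfolding backward_def w_def
      by (rule duhamel_sum[OF semigroup_adj, where T = T]) (use that L2_reflect[OF WL2[OF h(1)]] in auto)
    have \<psi>w: "?\<psi> w s = (\<Sum>j<m. c (n + j) *\<^sub>R ?\<psi> (h j) s)" if "s \<in> {0..T}" for s
      using bounded_linear.linear[OF bounded_linear_adjoint[OF bounded_B]]
      by (simp add: bw[OF that] linear_sum linear_scale)
    have sum_p: "(\<Sum>i<n + m. c i *\<^sub>R p i s) = g s + ?\<psi> w s" if "s \<in> {0..T}" for s
      unfolding sum_split_lessThan by (simp add: p_def g_def \<psi>w[OF that])
    \<comment> \<open>The relation \<open>g + ?\<psi> w = observe x\<close> says that this backward solution is observed as \<open>g\<close>.\<close>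
    define z where "z t = S_adj (T - t) x - backward w t" for t
    have "backward_mild_solution (adjoint_op A) T w x z"
      unfolding backward_mild_solution_def mild_solution_def
    proof (intro exI[of _ S_adj] conjI gen_adj ballI)
      fix t assume t: "t \<in> {0..T}"
      have "duhamel S_adj (\<lambda>s. - w (T - s)) t = - backward w (T - t)"
        unfolding backward_def using duhamel_uminus[OF semigroup_adj L2_reflect[OF WL2[OF w]] t] by simp
      then show "z (T - t) = S_adj t x + integral {0..t} (\<lambda>s. S_adj (t - s) (- w (T - s)))"
        by (simp add: z_def duhamel_def)
    qed
    moreover have "L2_eq T (\<lambda>t. adjoint B (z t)) g"
      using cx AE_space[of "Leb T"] unfolding L2_eq_def
    proof eventually_elim
      case (elim s)
      then have "observe x s = g s + ?\<psi> w s" using sum_p[of s] by simp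
      then show ?case
        using linear_diff[OF bounded_linear.linear[OF bounded_linear_adjoint[OF bounded_B]]]
        by (simp add: z_def observe_def)
    qed
    ultimately have g0: "L2_eq T g (\<lambda>t. 0)" and w0: "L2_eq T w (\<lambda>t. 0)"
      using unique_continuation[OF g w] by blast+
    have 1: "(\<Sum>i<n. c i * L2_inner T f (e i)) = L2_inner T f g" if "f \<in> L2 T" for f
      unfolding g_def using that e GL2 by (intro L2_inner_sum_right[symmetric]) auto
    have 2: "(\<Sum>j<m. c (n + j) * L2_inner T f (h j)) = L2_inner T f w" if "f \<in> L2 T" for f
      unfolding w_def using that h WL2 by (intro L2_inner_sum_right[symmetric]) auto
    have 3: "(\<Sum>j<m. c (n + j) * L2_inner T u1 (?\<psi> (h j))) = L2_inner T (steer u1) w"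
      using 2[OF L2_steer[OF u1(1)]] h WL2 by (simp add: L2_inner_steer[OF u1(1)])
    have "(\<Sum>i<n + m. c i * r i) = (L2_inner T gs g - L2_inner T u1 g)
        + (L2_inner T ws w - L2_inner T ?y0 w - L2_inner T (steer u1) w)"
      unfolding sum_split_lessThan
      by (simp add: r_def right_diff_distrib sum_subtractf 1[OF GL2[OF gs]] 1[OF u1(1)]
          2[OF WL2[OF ws]] 2[OF y0] 3)
    also have "\<dots> = 0"
      using L2_inner_cong_right[OF _ GL2[OF g] L2_zero g0] L2_inner_cong_right[OF _ WL2[OF w] L2_zero w0]
        GL2[OF gs] WL2[OF ws] u1(1) y0 L2_steer[OF u1(1)]
      by (simp add: L2_inner_def)
    finally show ?thesis .
  qed
  have "\<exists>u\<in>L2 T. steer u T = 0 \<and> (\<forall>i<n + m. L2_inner T u (p i) = r i)"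
  proof (rule null_control_with_moments)
    show "p i \<in> L2 T" if "i < n + m" for i using that by (rule p)
    show "(\<Sum>i<n + m. c i * r i) = 0" if "L2_eq T (\<lambda>s. \<Sum>i<n + m. c i *\<^sub>R p i s) (observe x)" for c x
      using that by (rule compat)
  qed
  then obtain u0 where u0: "u0 \<in> L2 T" "steer u0 T = 0" "\<And>i. i < n + m \<Longrightarrow> L2_inner T u0 (p i) = r i"
    by blast
  \<comment> \<open>The sum \<open>u1 + u0\<close>, in the form to which \<open>steer_end_diff\<close> applies.\<close>
  define u where "u = (\<lambda>s. u1 s - (- u0 s))"
  have mu0: "(\<lambda>s. - u0 s) \<in> L2 T" "steer (\<lambda>s. - u0 s) T = 0"
    using steer_end_diff[OF L2_zero u0(1)] steer_end_diff[OF L2_zero L2_zero] u0 L2_uminus by auto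
  have u: "u \<in> L2 T" unfolding u_def by (rule L2_diff[OF u1(1) mu0(1)])
  have inner_u: "L2_inner T u f = L2_inner T u1 f + L2_inner T u0 f" if "f \<in> L2 T" for f
    using L2_inner_add_left[OF u1(1) u0(1) that] by (simp add: u_def)
  define y where "y = (\<lambda>t. S t y0 + steer u t)"
  have y: "y \<in> L2 T" unfolding y_def by (rule L2_add[OF y0 L2_steer[OF u]])
  have "L2_projection T G u gs"
  proof (rule L2_projectionI_spanning[OF G e u gs])
    show "L2_inner T u (e i) = L2_inner T gs (e i)" if "i < n" for i
      using u0(3)[of i] that inner_u[OF GL2[OF e(1)[OF that]]] by (simp add: p_def r_def)
  qed
  moreover have "mild_solution A T (\<lambda>t. B (u t)) y0 y"
    unfolding mild_solution_def using gen
    by (intro exI[of _ S]) (simp add: y_def steer_def duhamel_def)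
  moreover have "y T = y1"
    unfolding y_def u_def by (simp only: steer_end_diff[OF u1(1) mu0(1)] u1(2) mu0(2)) simp
  moreover have "L2_projection T W y ws"
  proof (rule L2_projectionI_spanning[OF W h y ws])
    fix j assume j: "j < m"
    have hj: "h j \<in> L2 T" by (rule WL2[OF h(1)[OF j]])
    have "L2_inner T y (h j) = L2_inner T ?y0 (h j) + L2_inner T (steer u) (h j)"
      unfolding y_def by (rule L2_inner_add_left[OF y0 L2_steer[OF u] hj])
    also have "L2_inner T (steer u) (h j) = L2_inner T u1 (?\<psi> (h j)) + L2_inner T u0 (?\<psi> (h j))"
      by (simp add: L2_inner_steer[OF u hj] inner_u[OF L2_adjoint_B_backward[OF hj]])
    also have "L2_inner T u0 (?\<psi> (h j)) = r (n + j)" using u0(3)[of "n + j"] j by (simp add: p_def)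
    finally show "L2_inner T y (h j) = L2_inner T ws (h j)" by (simp add: r_def)
  qed
  ultimately show "\<exists>u\<in>L2 T. L2_projection T G u gs \<and>
      (\<exists>y. mild_solution A T (\<lambda>t. B (u t)) y0 y \<and> y T = y1 \<and> L2_projection T W y ws)"
    using u by blast
qed

end
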